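(* Suppose that $\mathbb{A}$ is not $\mathbb{C}$-elliptic. Let $B$ denote the unit ball of $\mathbb{R}^n$. Then there exists a vector $\xi_1\in\mathbb{R}^n\setminus\{0\}$ such that, for the half ball $B^+:=\{x\in B:\langle\xi_1,x\rangle>0\}$ and the hyperplane $\mathfrak{H}:=\{x\in\mathbb{R}^n:\langle\xi_1,x\rangle=0\}$, there exists a function $u\in W^{\mathbb{A},1}(B^+)\cap C^\infty(B^+)$ such that $u\notin L^1(\mathfrak{H}\cap B,\mathcal{H}^{n-1})$; that is, for $\mathcal{H}^{n-1}$-a.e. $x_0\in\mathfrak{H}\cap B$ the boundary value $|u|(x_0):=\lim_{y\to x_0,\,y\in B^+}|u(y)|$ exists in $[0,\infty]$, and $\int_{\mathfrak{H}\cap B}|u|\,d\mathcal{H}^{n-1}=\infty$.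
   Context: $\mathbb{A}=\sum_{\alpha=1}^n\mathbb{A}_\alpha\partial_\alpha$ is a constant-coefficient operator with linear maps $\mathbb{A}_\alpha:\mathbb{R}^N\to\mathbb{R}^K$. For $\xi\in\mathbb{C}^n$, $\eta\in\mathbb{C}^N$ put $\mathbb{A}[\xi]\eta:=\sum_\alpha\xi_\alpha\mathbb{A}_\alpha\eta$. $\mathbb{A}$ is $\mathbb{C}$-elliptic if $\mathbb{A}[\xi]:\mathbb{C}^N\to\mathbb{C}^K$ is injective for all $\xi\in\mathbb{C}^n\setminus\{0\}$. $W^{\mathbb{A},1}(B^+)$ is the space of $u\in L^1(B^+;\mathbb{R}^N)$ with distributional $\mathbb{A}u\in L^1(B^+;\mathbb{R}^K)$. $\mathcal{H}^{n-1}$ is the $(n-1)$-dimensional Hausdorff measure. *)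

theory Defs
  imports "HOL-Analysis.Analysis"
begin

section \<open>First-order constant-coefficient operators\<close>

text \<open>
  The operator \<open>\<Sum>\<alpha>. A \<alpha> \<partial>\<^sub>\<alpha>\<close> on \<open>\<real>\<^sup>n\<close> is represented by its coefficient family
  \<open>A :: 'n \<Rightarrow> real ^ 'N \<Rightarrow> real ^ 'K\<close>, each \<open>A \<alpha>\<close> being linear. In the symbol, a real linear
  map is extended complex-linearly, \<open>L (v + \<i> w) = L v + \<i> L w\<close>.
\<close>

definition complexify :: "(real ^ 'N \<Rightarrow> real ^ 'K) \<Rightarrow> complex ^ 'N \<Rightarrow> complex ^ 'K" where
  "complexify L \<eta> = (\<chi> k. Complex (L (\<chi> j. Re (\<eta> $ j)) $ k) (L (\<chi> j. Im (\<eta> $ j)) $ k))"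

definition op_symbol ::
  "('n::finite \<Rightarrow> real ^ 'N \<Rightarrow> real ^ 'K) \<Rightarrow> complex ^ 'n \<Rightarrow> complex ^ 'N \<Rightarrow> complex ^ 'K" where
  "op_symbol A \<xi> \<eta> = (\<Sum>\<alpha>\<in>UNIV. \<xi> $ \<alpha> *s complexify (A \<alpha>) \<eta>)"

definition C_elliptic :: "('n::finite \<Rightarrow> real ^ 'N \<Rightarrow> real ^ 'K) \<Rightarrow> bool" where
  "C_elliptic A \<longleftrightarrow> (\<forall>\<xi>. \<xi> \<noteq> 0 \<longrightarrow> inj (op_symbol A \<xi>))"


section \<open>Smooth functions, test functions and the space \<open>W\<^sup>A\<^sup>,\<^sup>1\<close>\<close>

text \<open>
  Here \<open>S\<close> is meant to be open, so that the derivatives at points of \<open>S\<close> do not depend on the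
  values outside \<open>S\<close>.
\<close>

fun Ck_on :: "nat \<Rightarrow> 'a::real_normed_vector set \<Rightarrow> ('a \<Rightarrow> 'b::real_normed_vector) \<Rightarrow> bool" where
  "Ck_on 0 S f \<longleftrightarrow> continuous_on S f"
| "Ck_on (Suc k) S f \<longleftrightarrow>
     (\<forall>x\<in>S. f differentiable (at x)) \<and> (\<forall>v. Ck_on k S (\<lambda>x. frechet_derivative f (at x) v))"

definition Cinf_on :: "'a::real_normed_vector set \<Rightarrow> ('a \<Rightarrow> 'b::real_normed_vector) set" where
  "Cinf_on S = {f. \<forall>k. Ck_on k S f}"

definition test_functions :: "'a::real_normed_vector set \<Rightarrow> ('a \<Rightarrow> real) set" where
  "test_functions \<Omega> =
     {\<phi> \<in> Cinf_on UNIV. compact (closure (support_on UNIV \<phi>)) \<and> closure (support_on UNIV \<phi>) \<subseteq> \<Omega>}"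

text \<open>
  \<open>distributional_op A \<Omega> u g\<close>: the distribution \<open>A u = \<Sum>\<alpha>. A \<alpha> (\<partial>\<^sub>\<alpha> u)\<close> on \<open>\<Omega>\<close> is represented
  by \<open>g\<close>. Testing the \<open>\<real>\<^sup>K\<close>-valued distribution with scalar functions amounts to testing each of
  its components.
\<close>

definition distributional_op ::
  "('n::finite \<Rightarrow> real ^ 'N \<Rightarrow> real ^ 'K) \<Rightarrow> (real ^ 'n) set \<Rightarrow>
     (real ^ 'n \<Rightarrow> real ^ 'N) \<Rightarrow> (real ^ 'n \<Rightarrow> real ^ 'K) \<Rightarrow> bool" where
  "distributional_op A \<Omega> u g \<longleftrightarrow>
     (\<forall>\<phi>\<in>test_functions \<Omega>.
        (LINT x:\<Omega>|lebesgue. \<phi> x *\<^sub>R g x) =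
        - (LINT x:\<Omega>|lebesgue.
             (\<Sum>\<alpha>\<in>UNIV. frechet_derivative \<phi> (at x) (axis \<alpha> 1) *\<^sub>R A \<alpha> (u x))))"

definition W_A1 ::
  "('n::finite \<Rightarrow> real ^ 'N \<Rightarrow> real ^ 'K) \<Rightarrow> (real ^ 'n) set \<Rightarrow> (real ^ 'n \<Rightarrow> real ^ 'N) set" where
  "W_A1 A \<Omega> =
     {u. u absolutely_integrable_on \<Omega> \<and>
         (\<exists>g. g absolutely_integrable_on \<Omega> \<and> distributional_op A \<Omega> u g)}"


section \<open>Hausdorff measure of integer dimension\<close>

text \<open>
  The normalising constant is the volume of the unit ball of \<open>\<real>\<^sup>m\<close>. The empty set is treated
  separately because of \<open>0 ^ 0 = 1\<close>, which is the right value for a singleton when \<open>m = 0\<close>.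
\<close>

definition hausdorff_cost :: "nat \<Rightarrow> 'a::metric_space set \<Rightarrow> ennreal" where
  "hausdorff_cost m C =
     (if C = {} then 0 else ennreal (unit_ball_vol (real m) * (diameter C / 2) ^ m))"

text \<open>
  Boundedness of the covering sets has to be required explicitly: \<^const>\<open>diameter\<close> is
  real-valued and carries no information on unbounded sets.
\<close>

definition hausdorff_premeasure :: "nat \<Rightarrow> real \<Rightarrow> 'a::metric_space set \<Rightarrow> ennreal" where
  "hausdorff_premeasure m \<delta> E =
     (INF C \<in> {C :: nat \<Rightarrow> 'a set. E \<subseteq> (\<Union>i. C i) \<and> (\<forall>i. bounded (C i) \<and> diameter (C i) \<le> \<delta>)}.
        (\<Sum>i. hausdorff_cost m (C i)))"

definition hausdorff_outer :: "nat \<Rightarrow> 'a::metric_space set \<Rightarrow> ennreal" where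
  "hausdorff_outer m E = (SUP \<delta>\<in>{0<..}. hausdorff_premeasure m \<delta> E)"

text \<open>The restriction of the outer measure to its Caratheodory-measurable sets.\<close>

definition hausdorff_measure :: "nat \<Rightarrow> 'a::metric_space measure" where
  "hausdorff_measure m =
     measure_of UNIV (lambda_system UNIV UNIV (hausdorff_outer m)) (hausdorff_outer m)"

lemma hausdorff_premeasure_le:
  assumes "E \<subseteq> (\<Union>i. C i)" "\<And>i. bounded (C i)" "\<And>i. diameter (C i) \<le> \<delta>"
  shows "hausdorff_premeasure m \<delta> E \<le> (\<Sum>i. hausdorff_cost m (C (i::nat)))"
  unfolding hausdorff_premeasure_def by (rule INF_lower) (use assms in auto)

lemma hausdorff_premeasure_subadditive:
  "hausdorff_premeasure m \<delta> (\<Union>i. E i) \<le> (\<Sum>i. hausdorff_premeasure m \<delta> (E (i::nat)))"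
proof (cases "\<exists>i. hausdorff_premeasure m \<delta> (E i) = top")
  case True
  then obtain i where i: "hausdorff_premeasure m \<delta> (E i) = top" by blast
  have "hausdorff_premeasure m \<delta> (E i) \<le> (\<Sum>i. hausdorff_premeasure m \<delta> (E i))"
    using sum_le_suminf[of "\<lambda>i. hausdorff_premeasure m \<delta> (E i)" "{i}"] by simp
  then show ?thesis using i by (simp add: top_unique)
next
  case False
  show ?thesis
  proof (rule ennreal_le_epsilon)
    fix e :: real assume e: "0 < e"
    have "\<exists>C. E i \<subseteq> (\<Union>j. C j) \<and> (\<forall>j. bounded (C j) \<and> diameter (C j) \<le> \<delta>) \<and>
        (\<Sum>j. hausdorff_cost m (C (j::nat)))
          \<le> hausdorff_premeasure m \<delta> (E i) + ennreal (e * (1/2) ^ Suc i)" for i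
    proof -
      have "hausdorff_premeasure m \<delta> (E i)
              < hausdorff_premeasure m \<delta> (E i) + ennreal (e * (1/2) ^ Suc i)"
        using False e by (simp add: ennreal_zero_less_mult_iff top.not_eq_extremum)
      then show ?thesis
        by (subst (asm) hausdorff_premeasure_def) (auto simp: INF_less_iff intro: less_imp_le)
    qed
    then obtain C where C: "\<And>i. E i \<subseteq> (\<Union>j. C i j)"
        "\<And>i j. bounded (C i j)" "\<And>i j. diameter (C i j) \<le> \<delta>"
        "\<And>i. (\<Sum>j. hausdorff_cost m (C i (j::nat)))
            \<le> hausdorff_premeasure m \<delta> (E i) + ennreal (e * (1/2) ^ Suc i)"
      by metis
    define D where "D k = (case prod_decode k of (i, j) \<Rightarrow> C i j)" for k
    have "(\<Union>i. E i) \<subseteq> (\<Union>k. D k)"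
    proof
      fix x assume "x \<in> (\<Union>i. E i)"
      then obtain i j where "x \<in> C i j" using C(1) by blast
      then have "x \<in> D (prod_encode (i, j))" by (simp add: D_def)
      then show "x \<in> (\<Union>k. D k)" by blast
    qed
    then have "hausdorff_premeasure m \<delta> (\<Union>i. E i) \<le> (\<Sum>k. hausdorff_cost m (D k))"
      by (rule hausdorff_premeasure_le) (auto simp: D_def C split: prod.split)
    also have "\<dots> = (\<Sum>i. \<Sum>j. hausdorff_cost m (C i j))"
      using suminf_ennreal_2dimen[of "\<lambda>i. \<Sum>j. hausdorff_cost m (C i j)"
          "\<lambda>(i, j). hausdorff_cost m (C i j)"]
      by (simp add: D_def o_def case_prod_unfold)
    also have "\<dots> \<le> (\<Sum>i. hausdorff_premeasure m \<delta> (E i) + ennreal (e * (1/2) ^ Suc i))"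
      by (intro suminf_le C) auto
    also have "\<dots> = (\<Sum>i. hausdorff_premeasure m \<delta> (E i)) + (\<Sum>i. ennreal (e * (1/2) ^ Suc i))"
      by (rule suminf_add[symmetric]) auto
    also have "(\<Sum>i. ennreal (e * (1/2) ^ Suc i)) = ennreal e"
    proof (rule suminf_ennreal_eq)
      show "(\<lambda>i. e * (1/2) ^ Suc i) sums e"
        using sums_mult[OF power_half_series, of e] by simp
    qed (use e in auto)
    finally show "hausdorff_premeasure m \<delta> (\<Union>i. E i)
        \<le> (\<Sum>i. hausdorff_premeasure m \<delta> (E i)) + ennreal e" .
  qed
qed

lemma outer_measure_space_hausdorff:
  "outer_measure_space (UNIV :: 'a::metric_space set set) (hausdorff_outer m)"
  unfolding outer_measure_space_def
proof (intro conjI)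
  show "positive (UNIV :: 'a set set) (hausdorff_outer m)"
  proof -
    have "hausdorff_premeasure m \<delta> ({} :: 'a set) = 0" if "\<delta> > 0" for \<delta>
      using hausdorff_premeasure_le[of "{}" "\<lambda>_. {}" \<delta> m] that
      by (simp add: hausdorff_cost_def)
    then have "hausdorff_outer m ({} :: 'a set) = (SUP \<delta>\<in>{0::real<..}. 0)"
      unfolding hausdorff_outer_def by (intro SUP_cong) auto
    then show ?thesis
      by (simp add: positive_def)
  qed
  show "increasing (UNIV :: 'a set set) (hausdorff_outer m)"
    unfolding increasing_def hausdorff_outer_def hausdorff_premeasure_def
    by (intro ballI impI SUP_mono' INF_superset_mono) auto
  show "countably_subadditive (UNIV :: 'a set set) (hausdorff_outer m)"
    unfolding countably_subadditive_def
  proof (intro allI impI)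
    fix E :: "nat \<Rightarrow> 'a set"
    have "hausdorff_premeasure m \<delta> (\<Union>i. E i) \<le> (\<Sum>i. hausdorff_outer m (E i))" if "\<delta> > 0" for \<delta>
      using hausdorff_premeasure_subadditive[of m \<delta> E]
      by (rule order_trans) (intro suminf_le, auto simp: hausdorff_outer_def intro: SUP_upper that)
    then show "hausdorff_outer m (\<Union>i. E i) \<le> (\<Sum>i. hausdorff_outer m (E i))"
      unfolding hausdorff_outer_def[of m "\<Union>i. E i"] by (auto intro: SUP_least)
  qed
qed

lemma
  fixes E :: "'a::metric_space set"
  shows space_hausdorff_measure [simp]: "space (hausdorff_measure m :: 'a measure) = UNIV"
    and sets_hausdorff_measure:
      "sets (hausdorff_measure m :: 'a measure) = lambda_system UNIV UNIV (hausdorff_outer m)"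
    and emeasure_hausdorff_measure:
      "E \<in> lambda_system UNIV UNIV (hausdorff_outer m) \<Longrightarrow>
         emeasure (hausdorff_measure m) E = hausdorff_outer m E"
proof -
  interpret sigma_algebra UNIV "UNIV :: 'a set set"
    using sigma_algebra_Pow[of "UNIV :: 'a set"] by simp
  have ms: "measure_space (UNIV :: 'a set) (lambda_system UNIV UNIV (hausdorff_outer m)) (hausdorff_outer m)"
    using caratheodory_lemma[OF outer_measure_space_hausdorff] .
  then interpret L: sigma_algebra "UNIV :: 'a set" "lambda_system UNIV UNIV (hausdorff_outer m)"
    by (simp add: measure_space_def)
  show "space (hausdorff_measure m :: 'a measure) = UNIV"
    by (simp add: hausdorff_measure_def space_measure_of_conv)
  show "sets (hausdorff_measure m :: 'a measure) = lambda_system UNIV UNIV (hausdorff_outer m)"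
    by (simp add: hausdorff_measure_def L.sets_measure_of_eq)
  show "E \<in> lambda_system UNIV UNIV (hausdorff_outer m) \<Longrightarrow>
         emeasure (hausdorff_measure m) E = hausdorff_outer m E"
    using ms unfolding hausdorff_measure_def
    by (intro emeasure_measure_of_sigma) (auto simp: measure_space_def)
qed

end

theory Submission
  imports Defs "HOL-Complex_Analysis.Cauchy_Integral_Formula"
begin

text \<open>
  If \<open>\<xi> = \<xi>\<^sub>1 + \<i> \<xi>\<^sub>2\<close> and \<open>\<eta> = \<eta>\<^sub>1 + \<i> \<eta>\<^sub>2\<close> satisfy \<open>A[\<xi>] \<eta> = 0\<close>, then \<open>u x = Re (\<phi> (\<xi> \<bullet> x) \<eta>)\<close> solves
  \<open>A u = 0\<close> classically wherever \<open>\<phi>\<close> is holomorphic near \<open>\<xi> \<bullet> x\<close>; a function \<open>\<phi>\<close> on the right half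
  plane gives such a \<open>u\<close> on \<open>{x. \<xi>\<^sub>1 \<bullet> x > 0}\<close>. If a real \<open>\<xi> \<noteq> 0\<close> and a real \<open>\<eta> \<noteq> 0\<close> with
  \<open>A[\<xi>] \<eta> = 0\<close> exist, take \<open>\<phi> z = 1 / \<surd>z\<close>: then \<open>u\<close> is integrable and \<open>|u| = \<infinity>\<close> on the whole
  hyperplane. Otherwise \<open>\<xi>\<^sub>1, \<xi>\<^sub>2\<close> are linearly independent and so are \<open>\<eta>\<^sub>1, \<eta>\<^sub>2\<close>. Take
  \<open>\<phi> z = 1 / z\<close>, which is integrable in two dimensions but not along the line \<open>Re z = 0\<close>; the
  independence of \<open>\<eta>\<^sub>1, \<eta>\<^sub>2\<close> makes \<open>|u|\<close> comparable to \<open>1 / |\<xi> \<bullet> x|\<close>, so that the boundary value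
  exists, with value \<open>\<infinity>\<close>, also where \<open>\<xi> \<bullet> x = 0\<close>.

  Integrals along the hyperplane are bounded below by Lebesgue integrals over a slab: projecting
  along a coordinate axis transverse to the hyperplane, a set of diameter \<open>d\<close> has as preimage in the
  slab a subset of a box with \<open>n - 1\<close> sides of length \<open>2 d\<close>.
\<close>

subsection \<open>Borel sets are Hausdorff measurable\<close>

text \<open>A finite sum has finite terms, so the series is a convergent real series in disguise,
  and its tails tend to 0.\<close>

lemma suminf_tail_small_ennreal:
  fixes f :: "nat \<Rightarrow> ennreal"
  assumes "(\<Sum>i. f i) < \<infinity>" "0 < e"
  shows "\<exists>k. (\<Sum>i. f (i + k)) < e"
proof -
  have fin: "f i < \<infinity>" for i
    using assms(1) ennreal_suminf_lessD by blast
  define g where "g i = enn2real (f i)" for i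
  have g: "\<And>i. f i = ennreal (g i)" "\<And>i. 0 \<le> g i"
    using fin by (auto simp: g_def less_top)
  have sm: "summable g"
    using assms(1) g by (intro summable_suminf_not_top) auto
  then have *: "(\<lambda>k. \<Sum>i. g (i + k)) \<longlonglongrightarrow> 0"
    by (rule suminf_exist_split2)
  obtain e' where e': "0 < e'" "ennreal e' < e"
  proof (cases e rule: ennreal_cases)
    case (real r)
    then show thesis using assms(2) by (intro that[of "r / 2"]) (auto simp: ennreal_less_iff)
  next
    case top
    then show thesis by (intro that[of 1]) auto
  qed
  from order_tendstoD(2)[OF * e'(1)] obtain k where "(\<Sum>i. g (i + k)) < e'"
    by (auto simp: eventually_sequentially)
  moreover have "(\<Sum>i. f (i + k)) = ennreal (\<Sum>i. g (i + k))"
    unfolding g(1) by (rule suminf_ennreal2) (use g sm summable_iff_shift in auto)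
  ultimately show ?thesis
    using e' by (metis ennreal_leI less_imp_le order_le_less_trans)
qed

text \<open>Caratheodory's criterion for metric outer measures. The sets \<open>D k\<close> exhaust
  \<open>E - F\<close> and have positive distance from \<open>F\<close>, so additivity holds for
  them. What \<open>D k\<close> misses is covered by the annuli \<open>R j\<close> with
  \<open>j \<ge> k\<close>; their measures have a finite sum, so the error tends to 0.\<close>

lemma closed_in_lambda_system_metric_outer:
  fixes \<mu> :: "'a::metric_space set \<Rightarrow> ennreal"
  assumes outer: "outer_measure_space UNIV \<mu>"
    and sep: "\<And>A B d. 0 < d \<Longrightarrow> (\<And>x y. x \<in> A \<Longrightarrow> y \<in> B \<Longrightarrow> d \<le> dist x y) \<Longrightarrow> \<mu> A + \<mu> B \<le> \<mu> (A \<union> B)"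
    and F: "closed F"
  shows "F \<in> lambda_system UNIV UNIV \<mu>"
proof (cases "F = {}")
  case True
  then show ?thesis
    using outer by (auto simp: lambda_system_def outer_measure_space_def positive_def)
next
  case ne: False
  have zero: "\<mu> {} = 0"
    using outer by (auto simp: outer_measure_space_def positive_def)
  have mono: "\<mu> A \<le> \<mu> B" if "A \<subseteq> B" for A B
    using outer that by (auto simp: outer_measure_space_def increasing_def)
  \<comment> \<open>\<open>countably_subadditive\<close> speaks of disjoint families only; passing
    to \<open>disjointed A\<close> removes the restriction.\<close>
  have sub: "\<mu> (\<Union>i. A i) \<le> (\<Sum>i. \<mu> (A (i::nat)))" for A
  proof -
    have "\<mu> (\<Union>i. disjointed A i) \<le> (\<Sum>i. \<mu> (disjointed A i))"
      using outer disjoint_family_disjointed[of A]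
      by (simp add: outer_measure_space_def countably_subadditive_def)
    also have "\<dots> \<le> (\<Sum>i. \<mu> (A i))"
      by (intro suminf_le mono disjointed_subset) auto
    finally show ?thesis by (simp add: UN_disjointed_eq)
  qed
  define bin where "bin A B = (\<lambda>i::nat. if i = 0 then A else if i = 1 then B else {})" for A B :: "'a set"
  have sub2: "\<mu> (A \<union> B) \<le> \<mu> A + \<mu> B" for A B
  proof -
    have eq: "A \<union> B = (\<Union>i. bin A B i)" by (auto simp: bin_def split: if_splits)
    have "(\<Sum>i. \<mu> (bin A B i)) = (\<Sum>i\<in>{0,1}. \<mu> (bin A B i))"
      by (rule suminf_finite) (auto simp: bin_def zero)
    then show ?thesis using sub[of "bin A B"] by (simp add: eq[symmetric]) (simp add: bin_def)
  qed
  have main: "\<mu> (F \<inter> E) + \<mu> (E - F) \<le> \<mu> E" if fin: "\<mu> E < \<infinity>" for E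
  proof -
    define D where "D k = {x \<in> E. 1 / real (Suc k) \<le> infdist x F}" for k
    define R where "R k = {x \<in> E. 1 / real (Suc (Suc k)) \<le> infdist x F \<and> infdist x F < 1 / real (Suc k)}" for k
    have FD: "\<mu> (F \<inter> E) + \<mu> (D k) \<le> \<mu> E" for k
    proof -
      have "\<mu> (F \<inter> E) + \<mu> (D k) \<le> \<mu> (F \<inter> E \<union> D k)"
      proof (rule sep[of "1 / real (Suc k)"])
        fix x y assume "x \<in> F \<inter> E" "y \<in> D k"
        then have "infdist y F \<le> dist y x" "1 / real (Suc k) \<le> infdist y F"
          by (auto simp: D_def intro: infdist_le)
        then show "1 / real (Suc k) \<le> dist x y" by (simp add: dist_commute)
      qed simp
      also have "\<dots> \<le> \<mu> E" by (rule mono) (auto simp: D_def)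
      finally show ?thesis .
    qed
    \<comment> \<open>Annuli whose indices have the same parity are separated.\<close>
    have skip: "(\<Sum>j<n. \<mu> (R (2 * j + p))) \<le> \<mu> (\<Union>j<n. R (2 * j + p))" for n p
    proof (induction n)
      case 0 then show ?case by simp
    next
      case (Suc n)
      let ?d = "1 / real (2 * n + p) - 1 / real (Suc (2 * n + p))"
      have "\<mu> (\<Union>j<n. R (2 * j + p)) + \<mu> (R (2 * n + p)) \<le> \<mu> ((\<Union>j<n. R (2 * j + p)) \<union> R (2 * n + p))"
      \<comment> \<open>For \<open>n = 0\<close> the union is empty. The case is separate because
        \<open>?d\<close> is negative when also \<open>p = 0\<close>, as 1 / 0 = 0.\<close>
      proof (cases "n = 0")
        case True then show ?thesis by (simp add: zero)
      next
        case False
        show ?thesis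
        proof (rule sep[of ?d])
          show "0 < ?d"
            unfolding diff_gt_0_iff_gt by (rule divide_strict_left_mono) (use False in auto)
          fix x y assume "x \<in> (\<Union>j<n. R (2 * j + p))" "y \<in> R (2 * n + p)"
          then obtain j where j: "j < n" "x \<in> R (2 * j + p)" by auto
          have "1 / real (2 * n + p) \<le> 1 / real (Suc (Suc (2 * j + p)))"
            using j(1) by (intro divide_left_mono) auto
          then have "1 / real (2 * n + p) \<le> infdist x F" using j(2) by (auto simp: R_def)
          moreover have "infdist y F < 1 / real (Suc (2 * n + p))"
            using \<open>y \<in> R (2 * n + p)\<close> by (auto simp: R_def)
          ultimately show "?d \<le> dist x y"
            using infdist_triangle[of x F y] by linarith
        qed
      qed
      moreover have "(\<Union>j<n. R (2 * j + p)) \<union> R (2 * n + p) = (\<Union>j<Suc n. R (2 * j + p))"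
        by (auto simp: less_Suc_eq)
      ultimately show ?case using Suc by (auto intro: order_trans[rotated] add_right_mono)
    qed
    have skip': "(\<Sum>j<n. \<mu> (R (2 * j + p))) \<le> \<mu> E" for n p
      by (rule order_trans[OF skip mono]) (auto simp: R_def)
    have bound: "(\<Sum>j<n. \<mu> (R j)) \<le> \<mu> E + \<mu> E" for n
    proof -
      have "(\<Sum>j<n. \<mu> (R j)) \<le> (\<Sum>j<2*n. \<mu> (R j))" by (rule sum_mono2) auto
      also have "\<dots> = (\<Sum>j<n. \<mu> (R (2 * j + 0))) + (\<Sum>j<n. \<mu> (R (2 * j + 1)))"
        by (induction n) (auto simp: algebra_simps)
      also have "\<dots> \<le> \<mu> E + \<mu> E" by (intro add_mono skip')
      finally show ?thesis .
    qed
    have sumfin: "(\<Sum>j. \<mu> (R j)) < \<infinity>"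
    proof -
      have "(\<Sum>j. \<mu> (R j)) \<le> \<mu> E + \<mu> E"
        unfolding suminf_eq_SUP by (rule SUP_least) (rule bound)
      also have "\<dots> < \<infinity>" using fin by simp
      finally show ?thesis .
    qed
    show ?thesis
    proof (rule ennreal_le_epsilon)
      fix e :: real assume "0 < e"
      then obtain k where k: "(\<Sum>i. \<mu> (R (i + k))) < ennreal e"
        using suminf_tail_small_ennreal[OF sumfin, of "ennreal e"] by auto
      have "E - F \<subseteq> D k \<union> (\<Union>i. R (i + k))"
      proof
        fix x assume x: "x \<in> E - F"
        then have pos: "0 < infdist x F"
          using F ne by (metis DiffD2 in_closed_iff_infdist_zero infdist_nonneg less_eq_real_def)
        show "x \<in> D k \<union> (\<Union>i. R (i + k))"
        proof (cases "x \<in> D k")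
          case False
          \<comment> \<open>The least \<open>n\<close> with \<open>P n\<close> locates the annulus
            of \<open>x\<close>: the threshold is met at \<open>n\<close> but not at
            \<open>n - 1\<close>, and \<open>n > k\<close> because \<open>x\<close> is outside
            \<open>D k\<close>.\<close>
          define P where "P n \<longleftrightarrow> 1 / real (Suc n) \<le> infdist x F" for n
          obtain n0 where n0: "P n0"
            unfolding P_def using pos by (metis nat_approx_posE less_imp_le)
          define n where "n = (LEAST n. P n)"
          have Pn: "P n" unfolding n_def using n0 by (rule LeastI)
          have "\<not> P k" using False x by (auto simp: D_def P_def)
          have "k < n"
          proof (rule ccontr)
            assume "\<not> k < n"
            then have "1 / real (Suc k) \<le> 1 / real (Suc n)" by (intro divide_left_mono) auto
            then show False using Pn \<open>\<not> P k\<close> by (auto simp: P_def)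
          qed
          then obtain i where i: "n = Suc (i + k)"
            by (metis add.commute less_imp_Suc_add)
          have "\<not> P (i + k)" unfolding n_def using i n_def not_less_Least[of "i + k" P] by simp
          then have "x \<in> R (i + k)" using Pn x i by (auto simp: R_def P_def)
          then show ?thesis by blast
        qed simp
      qed
      then have "\<mu> (E - F) \<le> \<mu> (D k) + \<mu> (\<Union>i. R (i + k))"
        by (meson mono sub2 order_trans)
      also have "\<mu> (\<Union>i. R (i + k)) \<le> ennreal e"
        using sub[of "\<lambda>i. R (i + k)"] k by (meson less_imp_le order_trans)
      finally have "\<mu> (F \<inter> E) + \<mu> (E - F) \<le> (\<mu> (F \<inter> E) + \<mu> (D k)) + ennreal e"
        by (simp add: add_left_mono add.assoc)
      also have "\<dots> \<le> \<mu> E + ennreal e" by (intro add_right_mono FD)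
      finally show "\<mu> (F \<inter> E) + \<mu> (E - F) \<le> \<mu> E + ennreal e" .
    qed
  qed
  have "\<mu> (F \<inter> E) + \<mu> (E - F) = \<mu> E" for E
  proof (rule antisym)
    show "\<mu> (F \<inter> E) + \<mu> (E - F) \<le> \<mu> E"
      using main[of E] by (cases "\<mu> E = \<infinity>") (auto simp: less_top)
    have "E = (F \<inter> E) \<union> (E - F)" by auto
    then show "\<mu> E \<le> \<mu> (F \<inter> E) + \<mu> (E - F)" by (metis sub2)
  qed
  moreover have "(UNIV - F) \<inter> E = E - F" for E by auto
  ultimately show ?thesis by (auto simp: lambda_system_def)
qed

section \<open>Additivity of the Hausdorff outer measure on separated sets\<close>

lemma hausdorff_cost_mono:
  "A \<subseteq> B \<Longrightarrow> bounded B \<Longrightarrow> hausdorff_cost m A \<le> hausdorff_cost m B"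
  unfolding hausdorff_cost_def
  by (auto intro!: ennreal_leI mult_left_mono power_mono divide_right_mono diameter_subset diameter_ge_0
        unit_ball_vol_nonneg intro: bounded_subset)

lemma hausdorff_premeasure_antimono:
  "\<delta> \<le> \<delta>' \<Longrightarrow> hausdorff_premeasure m \<delta>' E \<le> hausdorff_premeasure m \<delta> E"
  unfolding hausdorff_premeasure_def by (rule INF_superset_mono) (auto intro: order_trans)

text \<open>A covering set of diameter below \<open>d\<close> cannot meet both \<open>A\<close> and
  \<open>B\<close>. Intersecting a fine cover of the union with \<open>A\<close> and with
  \<open>B\<close> therefore yields covers of both sets without raising the total cost.\<close>

lemma hausdorff_outer_separated:
  assumes "0 < d" and dist: "\<And>x y. x \<in> A \<Longrightarrow> y \<in> B \<Longrightarrow> d \<le> dist x y"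
  shows "hausdorff_outer m A + hausdorff_outer m B \<le> hausdorff_outer m (A \<union> B)"
proof -
  have small: "hausdorff_premeasure m \<delta> A + hausdorff_premeasure m \<delta> B \<le> hausdorff_premeasure m \<delta> (A \<union> B)"
    if \<delta>: "\<delta> < d" for \<delta>
    unfolding hausdorff_premeasure_def[of m \<delta> "A \<union> B"]
  proof (rule INF_greatest, clarify)
    fix C :: "nat \<Rightarrow> 'a set"
    assume C: "A \<union> B \<subseteq> (\<Union>i. C i)" "\<forall>i. bounded (C i) \<and> diameter (C i) \<le> \<delta>"
    have small_diam: "bounded (C i \<inter> X)" "diameter (C i \<inter> X) \<le> \<delta>" for i X
      using C(2) diameter_subset[of "C i \<inter> X" "C i"] by (auto intro: bounded_subset order_trans)
    have one: "hausdorff_cost m (C i \<inter> A) + hausdorff_cost m (C i \<inter> B) \<le> hausdorff_cost m (C i)" for i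
    proof -
      have "C i \<inter> A = {} \<or> C i \<inter> B = {}"
      proof (rule ccontr)
        assume "\<not> ?thesis"
        then obtain x y where xy: "x \<in> C i" "x \<in> A" "y \<in> C i" "y \<in> B" by auto
        then have "dist x y \<le> diameter (C i)" using C(2) by (intro diameter_bounded_bound) auto
        then show False using dist[of x y] xy C(2) \<delta> by (meson not_less order_trans order_le_less_trans)
      qed
      then show ?thesis
        using C(2) hausdorff_cost_mono[of _ "C i" m]
        by (auto simp: hausdorff_cost_def[of m "{}"])
    qed
    have "hausdorff_premeasure m \<delta> A + hausdorff_premeasure m \<delta> B
        \<le> (\<Sum>i. hausdorff_cost m (C i \<inter> A)) + (\<Sum>i. hausdorff_cost m (C i \<inter> B))"
      using C(1) by (intro add_mono hausdorff_premeasure_le small_diam) auto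
    also have "\<dots> = (\<Sum>i. hausdorff_cost m (C i \<inter> A) + hausdorff_cost m (C i \<inter> B))"
      by (rule suminf_add) auto
    also have "\<dots> \<le> (\<Sum>i. hausdorff_cost m (C i))" by (intro suminf_le one) auto
    finally show "hausdorff_premeasure m \<delta> A + hausdorff_premeasure m \<delta> B \<le> (\<Sum>i. hausdorff_cost m (C i))" .
  qed
  have "hausdorff_premeasure m \<delta> A + hausdorff_premeasure m \<delta>' B \<le> hausdorff_outer m (A \<union> B)"
    if "0 < \<delta>" "0 < \<delta>'" for \<delta> \<delta>'
  proof -
    \<comment> \<open>The scales \<delta> and \<delta>' stay independent so that the two suprema can
      be taken one after the other; \<open>t\<close> lies below both and below
      \<open>d\<close>.\<close>
    define t where "t = min (min \<delta> \<delta>') (d / 2)"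
    have t: "0 < t" "t < d" "t \<le> \<delta>" "t \<le> \<delta>'" using that assms by (auto simp: t_def min_def)
    have "hausdorff_premeasure m \<delta> A + hausdorff_premeasure m \<delta>' B
        \<le> hausdorff_premeasure m t A + hausdorff_premeasure m t B"
      by (intro add_mono hausdorff_premeasure_antimono t)
    also have "\<dots> \<le> hausdorff_premeasure m t (A \<union> B)" by (rule small) (rule t)
    also have "\<dots> \<le> hausdorff_outer m (A \<union> B)"
      unfolding hausdorff_outer_def by (rule SUP_upper) (use t in auto)
    finally show ?thesis .
  qed
  then have "(SUP \<delta>\<in>{0<..}. hausdorff_premeasure m \<delta> A + hausdorff_premeasure m \<delta>' B) \<le> hausdorff_outer m (A \<union> B)"
    if "0 < \<delta>'" for \<delta>'
    using that by (intro SUP_least) auto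
  then have "hausdorff_outer m A + hausdorff_premeasure m \<delta>' B \<le> hausdorff_outer m (A \<union> B)" if "0 < \<delta>'" for \<delta>'
    using that unfolding hausdorff_outer_def[of m A] by (subst (asm) ennreal_SUP_add_left) auto
  then have "(SUP \<delta>'\<in>{0<..}. hausdorff_outer m A + hausdorff_premeasure m \<delta>' B) \<le> hausdorff_outer m (A \<union> B)"
    by (intro SUP_least) auto
  then show ?thesis
    unfolding hausdorff_outer_def[of m B] by (simp add: ennreal_SUP_add_right)
qed

lemma borel_subset_sets_hausdorff:
  "sets (borel :: 'a::metric_space measure) \<subseteq> sets (hausdorff_measure m)"
proof -
  have "sigma_sets UNIV (Collect closed) \<subseteq> sets (hausdorff_measure m :: 'a measure)"
  proof (rule sets.sigma_sets_subset'[of _ _ ])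
    show "Collect closed \<subseteq> sets (hausdorff_measure m :: 'a measure)"
      unfolding sets_hausdorff_measure
      by (auto intro!: closed_in_lambda_system_metric_outer outer_measure_space_hausdorff
            hausdorff_outer_separated)
    show "UNIV \<in> sets (hausdorff_measure m :: 'a measure)"
      using sets.top[of "hausdorff_measure m :: 'a measure"] by simp
  qed
  then show ?thesis by (simp add: borel_eq_closed)
qed

lemma emeasure_hausdorff_borel:
  "E \<in> sets borel \<Longrightarrow> emeasure (hausdorff_measure m) E = hausdorff_outer m E"
  using borel_subset_sets_hausdorff[of m] emeasure_hausdorff_measure[of E m]
  by (auto simp: sets_hausdorff_measure)

subsection \<open>Lebesgue integrals over a slab bounded by Hausdorff integrals\<close>

text \<open>Moves the constant to the smaller side, so that an infimum stands alone on the right and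
  \<open>INF_greatest\<close> applies.\<close>

lemma ennreal_le_mult_iff:
  assumes "0 < r"
  shows "x \<le> ennreal r * y \<longleftrightarrow> ennreal (1 / r) * x \<le> y"
proof -
  have cancel: "ennreal r * (ennreal (1 / r) * z) = z" "ennreal (1 / r) * (ennreal r * z) = z" for z
    using assms by (simp_all add: mult.assoc[symmetric] ennreal_mult[symmetric])
  show ?thesis
    using mult_left_mono[of x "ennreal r * y" "ennreal (1 / r)"]
      mult_left_mono[of "ennreal (1 / r) * x" y "ennreal r"] by (auto simp: cancel)
qed

text \<open>Since \<open>q\<close> changes the \<open>k\<close>-th coordinate only, the slab points
  that \<open>q\<close> sends into a set of diameter d lie in a box with one side of length 1 and
  all others of length 2 d. The constant is the ratio of its volume (2 d)^m to the Hausdorff cost V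
  (d / 2)^m.\<close>

lemma emeasure_le_hausdorff_outer:
  fixes q :: "real ^ 'n::finite \<Rightarrow> real ^ 'n"
  assumes q: "q \<in> borel_measurable borel" "\<And>x l. l \<noteq> k \<Longrightarrow> q x $ l = x $ l"
    and E: "E \<in> sets borel"
  shows "emeasure lborel {x. 0 \<le> x $ k \<and> x $ k \<le> 1 \<and> q x \<in> E}
    \<le> ennreal (4 ^ (CARD('n) - 1) / unit_ball_vol (real (CARD('n) - 1)))
        * hausdorff_outer (CARD('n) - 1) E"
proof -
  define m where "m = CARD('n) - 1"
  define V where "V = unit_ball_vol (real m)"
  have V: "0 < V" by (simp add: V_def)
  let ?S = "{x. 0 \<le> x $ k \<and> x $ k \<le> 1 \<and> q x \<in> E}"
  have cover: "emeasure lborel ?S \<le> ennreal (4 ^ m / V) * (\<Sum>i. hausdorff_cost m (C i))"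
    if C: "E \<subseteq> (\<Union>i. C i)" "\<And>i. bounded (C i)" for C :: "nat \<Rightarrow> (real ^ 'n) set"
  proof -
    define c where "c i = (SOME x. x \<in> C i)" for i
    define d where "d i = diameter (C i)" for i
    \<comment> \<open>An empty \<open>C i\<close> has cost 0, but the box formula would give it
      volume 1 when \<open>m = 0\<close>; hence the separate case.\<close>
    define Q where "Q i = (if C i = {} then {} else
       cbox (\<chi> l. if l = k then 0 else c i $ l - d i) (\<chi> l. if l = k then 1 else c i $ l + d i))" for i
    have d: "0 \<le> d i" for i using C(2) by (simp add: d_def diameter_ge_0)
    have "?S \<subseteq> (\<Union>i. Q i)"
    proof
      fix x assume x: "x \<in> ?S"
      then obtain i where i: "q x \<in> C i" using C(1) by auto
      then have "c i \<in> C i" unfolding c_def by (rule someI)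
      then have "dist (q x) (c i) \<le> d i"
        unfolding d_def using C(2) i by (intro diameter_bounded_bound)
      then have "\<bar>q x $ l - c i $ l\<bar> \<le> d i" for l
        using component_le_norm_cart[of "q x - c i" l] by (simp add: dist_norm)
      then have "\<bar>x $ l - c i $ l\<bar> \<le> d i" if "l \<noteq> k" for l using q(2)[OF that, of x] by metis
      then have "x \<in> Q i" using i x by (force simp: Q_def mem_box_cart abs_le_iff)
      then show "x \<in> (\<Union>i. Q i)" by blast
    qed
    then have "emeasure lborel ?S \<le> emeasure lborel (\<Union>i. Q i)"
      by (rule emeasure_mono) (auto simp: Q_def)
    also have "\<dots> \<le> (\<Sum>i. emeasure lborel (Q i))"
      by (rule emeasure_subadditive_countably) (auto simp: Q_def)
    also have "\<dots> \<le> (\<Sum>i. ennreal (4 ^ m / V) * hausdorff_cost m (C i))"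
    proof (intro suminf_le allI)
      fix i
      show "emeasure lborel (Q i) \<le> ennreal (4 ^ m / V) * hausdorff_cost m (C i)"
      proof (cases "C i = {}")
        case False
        let ?a = "\<chi> l. if l = k then 0 else c i $ l - d i"
        let ?b = "\<chi> l. if l = k then 1 else c i $ l + d i"
        have "cbox ?a ?b \<noteq> {}" using d[of i] by (auto simp: interval_ne_empty_cart)
        then have "measure lborel (cbox ?a ?b) = (\<Prod>l\<in>UNIV. ?b $ l - ?a $ l)"
          by (rule content_cbox_cart)
        also have "\<dots> = (\<Prod>l\<in>UNIV - {k}. 2 * d i)"
          by (subst prod.remove[of _ k]) (auto intro!: prod.cong)
        also have "\<dots> = (2 * d i) ^ m" by (simp add: m_def card_Diff_singleton)
        finally have content: "measure lborel (cbox ?a ?b) = (2 * d i) ^ m" .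
        have "emeasure lborel (cbox ?a ?b) \<noteq> top"
          by (rule less_imp_neq) (rule emeasure_lborel_cbox_finite[unfolded infinity_ennreal_def])
        from emeasure_eq_ennreal_measure[OF this]
        have "emeasure lborel (cbox ?a ?b) = ennreal ((2 * d i) ^ m)"
          unfolding content .
        also have "(2 * d i) ^ m = 4 ^ m / V * (V * (d i / 2) ^ m)"
        proof -
          have "(2 * d i) ^ m = (4 * (d i / 2)) ^ m" by simp
          also have "\<dots> = 4 ^ m * (d i / 2) ^ m" by (rule power_mult_distrib)
          finally show ?thesis using V by simp
        qed
        also have "ennreal \<dots> = ennreal (4 ^ m / V) * hausdorff_cost m (C i)"
          using V d[of i] False by (subst ennreal_mult) (auto simp: hausdorff_cost_def V_def d_def)
        finally show ?thesis using False by (simp add: Q_def)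
      qed (simp add: Q_def)
    qed auto
    also have "\<dots> = ennreal (4 ^ m / V) * (\<Sum>i. hausdorff_cost m (C i))"
      by (rule ennreal_suminf_cmult)
    finally show ?thesis .
  qed
  have r: "0 < 4 ^ m / V" using V by simp
  \<comment> \<open>\<open>cover\<close> holds for covers of any diameter, so the scale 1 is
    arbitrary.\<close>
  have "emeasure lborel ?S \<le> ennreal (4 ^ m / V) * hausdorff_premeasure m 1 E"
    unfolding ennreal_le_mult_iff[OF r] hausdorff_premeasure_def
    by (rule INF_greatest) (use cover[unfolded ennreal_le_mult_iff[OF r]] in blast)
  also have "\<dots> \<le> ennreal (4 ^ m / V) * hausdorff_outer m E"
    unfolding hausdorff_outer_def by (intro mult_left_mono SUP_upper) auto
  finally show ?thesis by (simp add: m_def V_def)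
qed

text \<open>A simple function for \<open>M\<close> is simple for \<open>N\<close>, and the bound on
  sets carries over to it term by term. Inclusion of the sigma-algebras is the form needed for Borel
  sets inside the Caratheodory sets.\<close>

lemma nn_integral_le_of_emeasure_le:
  assumes sp: "space M = space N" and sub: "sets M \<subseteq> sets N"
    and le: "\<And>E. E \<in> sets M \<Longrightarrow> emeasure M E \<le> c * emeasure N E"
  shows "(\<integral>\<^sup>+x. f x \<partial>M) \<le> c * (\<integral>\<^sup>+x. f x \<partial>N)"
  unfolding nn_integral_def[of M]
proof (rule SUP_least, clarify)
  fix g assume g: "simple_function M g" "g \<le> f"
  have g': "simple_function N g"
    using g(1) sub unfolding simple_function_def sp by blast
  have "integral\<^sup>S M g \<le> (\<Sum>y\<in>g ` space M. y * (c * emeasure N (g -` {y} \<inter> space M)))"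
    unfolding simple_integral_def
    by (intro sum_mono mult_left_mono le) (use g(1) in \<open>auto simp: simple_function_def\<close>)
  also have "\<dots> = c * integral\<^sup>S N g"
    unfolding simple_integral_def sp by (simp add: sum_distrib_left ac_simps)
  also have "integral\<^sup>S N g \<le> (\<integral>\<^sup>+x. f x \<partial>N)"
    unfolding nn_integral_def by (rule SUP_upper) (use g g' in auto)
  finally show "integral\<^sup>S M g \<le> c * (\<integral>\<^sup>+x. f x \<partial>N)" by (simp add: mult_left_mono)
qed

lemma nn_integral_le_hausdorff:
  fixes q :: "real ^ 'n::finite \<Rightarrow> real ^ 'n"
  assumes q [measurable]: "q \<in> borel_measurable borel" and ql: "\<And>x l. l \<noteq> k \<Longrightarrow> q x $ l = x $ l"
    and f [measurable]: "f \<in> borel_measurable borel"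
  shows "(\<integral>\<^sup>+x. f (q x) * indicator {x. 0 \<le> x $ k \<and> x $ k \<le> 1} x \<partial>lborel)
    \<le> ennreal (4 ^ (CARD('n) - 1) / unit_ball_vol (real (CARD('n) - 1)))
        * (\<integral>\<^sup>+y. f y \<partial>hausdorff_measure (CARD('n) - 1))"
proof -
  define S where "S = {x :: real ^ 'n. 0 \<le> x $ k \<and> x $ k \<le> 1}"
  have S [measurable]: "S \<in> sets borel" by (simp add: S_def)
  \<comment> \<open>The image under \<open>q\<close> of Lebesgue measure on the slab: integrating
    \<open>f\<close> against it is integrating \<open>f o q\<close> over the slab.\<close>
  define M where "M = distr (density lborel (indicator S)) borel q"
  have "(\<integral>\<^sup>+y. f y \<partial>M) \<le> ennreal (4 ^ (CARD('n) - 1) / unit_ball_vol (real (CARD('n) - 1)))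
        * (\<integral>\<^sup>+y. f y \<partial>hausdorff_measure (CARD('n) - 1))"
  proof (rule nn_integral_le_of_emeasure_le)
    show "sets M \<subseteq> sets (hausdorff_measure (CARD('n) - 1))"
      using borel_subset_sets_hausdorff by (simp add: M_def)
    fix E assume "E \<in> sets M"
    then have E [measurable]: "E \<in> sets borel" by (simp add: M_def)
    have "emeasure M E = emeasure lborel {x. 0 \<le> x $ k \<and> x $ k \<le> 1 \<and> q x \<in> E}"
      unfolding M_def
      by (subst emeasure_distr, simp, simp, subst emeasure_density, simp, simp)
         (auto simp: S_def indicator_inter_arith[symmetric] Int_def vimage_def intro!: arg_cong[where f = "emeasure lborel"])
    then show "emeasure M E \<le> ennreal (4 ^ (CARD('n) - 1) / unit_ball_vol (real (CARD('n) - 1)))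
        * emeasure (hausdorff_measure (CARD('n) - 1)) E"
      using emeasure_le_hausdorff_outer[OF q ql E] by (simp add: emeasure_hausdorff_borel E)
  qed (simp add: M_def)
  moreover have "(\<integral>\<^sup>+y. f y \<partial>M) = (\<integral>\<^sup>+x. f (q x) * indicator S x \<partial>lborel)"
    unfolding M_def by (simp add: nn_integral_distr nn_integral_density mult.commute)
  ultimately show ?thesis by (simp add: S_def)
qed

subsection \<open>Singular integrands\<close>

text \<open>
  Averaging over a segment of translates reduces the integrability of a function of \<open>\<zeta> \<bullet> x\<close> to a
  one-dimensional question, without a change of coordinates.
\<close>

lemma nn_integral_average_translates:
  fixes v :: "'a::euclidean_space" and f :: "'a \<Rightarrow> ennreal"
  assumes [measurable]: "f \<in> borel_measurable borel"
  shows "(\<integral>\<^sup>+x. f x \<partial>lborel) = (\<integral>\<^sup>+x. (\<integral>\<^sup>+s. f (x - s *\<^sub>R v) * indicator {0..1::real} s \<partial>lborel) \<partial>lborel)"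
proof -
  have translate: "(\<integral>\<^sup>+x. f (x - c) \<partial>lborel) = (\<integral>\<^sup>+x. f x \<partial>lborel)" for c
  proof -
    have "(\<integral>\<^sup>+x. f (- c + x) \<partial>lborel) = (\<integral>\<^sup>+x. f x \<partial>distr lborel borel ((+) (- c)))"
      by (subst nn_integral_distr) auto
    then show ?thesis by (simp add: lborel_distr_plus)
  qed
  have "(\<integral>\<^sup>+x. (\<integral>\<^sup>+s. f (x - s *\<^sub>R v) * indicator {0..1::real} s \<partial>lborel) \<partial>lborel)
      = (\<integral>\<^sup>+s. (\<integral>\<^sup>+x. f (x - s *\<^sub>R v) * indicator {0..1::real} s \<partial>lborel) \<partial>lborel)"
    by (rule lborel_pair.Fubini'[symmetric]) measurable
  also have "\<dots> = (\<integral>\<^sup>+s. (\<integral>\<^sup>+x. f x \<partial>lborel) * indicator {0..1::real} s \<partial>lborel)"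
    by (simp add: nn_integral_multc translate)
  also have "\<dots> = (\<integral>\<^sup>+x. f x \<partial>lborel)" by (simp add: nn_integral_cmult)
  finally show ?thesis by simp
qed

text \<open>Valued in the extended reals, so that \<open>inv_sqrt 0 = \<infinity>\<close>: real division would give \<open>0\<close>.\<close>

definition inv_sqrt :: "real \<Rightarrow> ennreal" where
  "inv_sqrt r = inverse (ennreal (sqrt \<bar>r\<bar>))"

lemma inv_sqrt_measurable [measurable]: "inv_sqrt \<in> borel_measurable borel"
  unfolding inv_sqrt_def by measurable

lemma inv_sqrt_minus [simp]: "inv_sqrt (- r) = inv_sqrt r"
  by (simp add: inv_sqrt_def)

lemma inv_sqrt_le_1: "1 \<le> \<bar>r\<bar> \<Longrightarrow> inv_sqrt r \<le> 1"
  unfolding inv_sqrt_def by (subst inverse_ennreal) (auto simp: ennreal_le_1 inverse_eq_divide)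

lemma nn_integral_inv_sqrt_finite: "(\<integral>\<^sup>+r. inv_sqrt r * indicator {-1..1} r \<partial>lborel) < \<infinity>"
proof -
  have half: "(\<integral>\<^sup>+r. inv_sqrt r * indicator {0..1} r \<partial>lborel) = 2"
  proof -
    have "(\<integral>\<^sup>+r. inv_sqrt r * indicator {0..1} r \<partial>lborel)
        = (\<integral>\<^sup>+r. ennreal (r powr (-1/2)) * indicator {0..1} r \<partial>lborel)"
    \<comment> \<open>The integrands differ at 0, where \<open>inv_sqrt\<close> is infinite and the
      real power is 0.\<close>
    proof (rule nn_integral_cong_AE, rule AE_mp[OF AE_lborel_singleton[of 0]], rule AE_I2, rule impI)
      fix r :: real assume "r \<noteq> 0"
      then show "inv_sqrt r * indicator {0..1} r = ennreal (r powr (-1/2)) * indicator {0..1} r"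
        by (auto simp: indicator_def inv_sqrt_def inverse_ennreal powr_minus powr_half_sqrt)
    qed
    also have "\<dots> = ennreal (1 powr (-1/2 + 1) / (-1/2 + 1))"
      by (rule nn_integral_has_integral_lebesgue'[OF _ has_integral_powr_from_0]) auto
    finally show ?thesis by simp
  qed
  have "(\<integral>\<^sup>+r. inv_sqrt r * indicator {-1..1} r \<partial>lborel)
      \<le> (\<integral>\<^sup>+r. inv_sqrt r * indicator {0..1} r + inv_sqrt (- r) * indicator {0..1} (- r) \<partial>lborel)"
    by (intro nn_integral_mono) (auto simp: indicator_def)
  also have "\<dots> = 2 + (\<integral>\<^sup>+r. inv_sqrt (- r) * indicator {0..1} (- r) \<partial>lborel)"
    by (subst nn_integral_add) (auto simp: half[simplified])
  also have "(\<integral>\<^sup>+r. inv_sqrt (- r) * indicator {0..1} (- r) \<partial>lborel) = 2"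
    using nn_integral_real_affine[of "\<lambda>r. inv_sqrt r * indicator {0..1} r" "-1" 0] half by simp
  finally show ?thesis by (simp add: order_le_less_trans)
qed

text \<open>Outside [-1, 1] the integrand is at most 1, so one constant serves all translates: 1
  plus the integral over [-1, 1].\<close>

lemma nn_integral_inv_sqrt_shift_bound:
  obtains C where "C < \<infinity>" "\<And>a. (\<integral>\<^sup>+s. inv_sqrt (a - s) * indicator {0..1} s \<partial>lborel) \<le> C"
proof
  let ?I = "\<integral>\<^sup>+r. inv_sqrt r * indicator {-1..1} r \<partial>lborel"
  show "1 + ?I < \<infinity>" using nn_integral_inv_sqrt_finite by simp
  fix a :: real
  have "(\<integral>\<^sup>+s. inv_sqrt (a - s) * indicator {0..1} s \<partial>lborel)
      \<le> (\<integral>\<^sup>+s. indicator {0..1} s + inv_sqrt (a - s) * indicator {-1..1} (a - s) \<partial>lborel)"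
    by (intro nn_integral_mono) (auto simp: indicator_def intro!: inv_sqrt_le_1)
  also have "\<dots> = 1 + (\<integral>\<^sup>+s. inv_sqrt (a - s) * indicator {-1..1} (a - s) \<partial>lborel)"
    by (subst nn_integral_add) auto
  also have "(\<integral>\<^sup>+s. inv_sqrt (a - s) * indicator {-1..1} (a - s) \<partial>lborel) = ?I"
    using nn_integral_real_affine[of "\<lambda>r. inv_sqrt r * indicator {-1..1} r" "-1" a] by simp
  finally show "(\<integral>\<^sup>+s. inv_sqrt (a - s) * indicator {0..1} s \<partial>lborel) \<le> 1 + ?I" .
qed

text \<open>Averaging over translates along \<open>v\<close> moves \<zeta> \<bullet> x at unit speed
  and leaves \<open>g\<close> fixed. The inner integral is then bounded uniformly in x, and
  \<open>g\<close> remains, on a ball enlarged by the length of \<open>v\<close>. Each application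
  splits off one singular factor.\<close>

lemma nn_integral_inv_sqrt_inner_bound:
  fixes \<zeta> v :: "'a::euclidean_space"
  assumes v: "\<zeta> \<bullet> v = 1" and [measurable]: "g \<in> borel_measurable borel"
    and g: "\<And>x s. g (x - s *\<^sub>R v) = g x"
    and fin: "(\<integral>\<^sup>+x. g x * indicator (ball 0 (r + norm v)) x \<partial>lborel) < \<infinity>"
  shows "(\<integral>\<^sup>+x. inv_sqrt (\<zeta> \<bullet> x) * g x * indicator (ball 0 r) x \<partial>lborel) < \<infinity>"
proof -
  obtain C where C: "C < \<infinity>" "\<And>a. (\<integral>\<^sup>+s. inv_sqrt (a - s) * indicator {0..1} s \<partial>lborel) \<le> C"
    using nn_integral_inv_sqrt_shift_bound by blast
  have [measurable]: "ball (0::'a) \<rho> \<in> sets borel" for \<rho> by simp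
  have "(\<integral>\<^sup>+x. inv_sqrt (\<zeta> \<bullet> x) * g x * indicator (ball 0 r) x \<partial>lborel)
     = (\<integral>\<^sup>+x. (\<integral>\<^sup>+s. inv_sqrt (\<zeta> \<bullet> (x - s *\<^sub>R v)) * g (x - s *\<^sub>R v) * indicator (ball 0 r) (x - s *\<^sub>R v)
          * indicator {0..1} s \<partial>lborel) \<partial>lborel)"
    by (rule nn_integral_average_translates) measurable
  also have "\<dots> \<le> (\<integral>\<^sup>+x. (\<integral>\<^sup>+s. (g x * indicator (ball 0 (r + norm v)) x) *
       (inv_sqrt (\<zeta> \<bullet> x - s) * indicator {0..1} s) \<partial>lborel) \<partial>lborel)"
  proof (intro nn_integral_mono)
    fix x s
    have "indicator (ball 0 r) (x - s *\<^sub>R v) \<le> (indicator (ball 0 (r + norm v)) x :: ennreal)" if "s \<in> {0..1}"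
    proof -
      have "norm x \<le> norm (x - s *\<^sub>R v) + norm (s *\<^sub>R v)" by (metis diff_add_cancel norm_triangle_ineq)
      moreover have "norm (s *\<^sub>R v) \<le> norm v" using that by (simp add: mult_left_le_one_le)
      ultimately show ?thesis by (auto simp: indicator_def)
    qed
    then show "inv_sqrt (\<zeta> \<bullet> (x - s *\<^sub>R v)) * g (x - s *\<^sub>R v) * indicator (ball 0 r) (x - s *\<^sub>R v)
          * indicator {0..1} s \<le> g x * indicator (ball 0 (r + norm v)) x *
            (inv_sqrt (\<zeta> \<bullet> x - s) * indicator {0..1} s)"
      by (auto simp: g v inner_diff_right indicator_def mult_ac split: if_splits)
  qed
  also have "\<dots> = (\<integral>\<^sup>+x. g x * indicator (ball 0 (r + norm v)) x *
       (\<integral>\<^sup>+s. inv_sqrt (\<zeta> \<bullet> x - s) * indicator {0..1} s \<partial>lborel) \<partial>lborel)"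
    by (intro nn_integral_cong nn_integral_cmult) measurable
  also have "\<dots> \<le> (\<integral>\<^sup>+x. g x * indicator (ball 0 (r + norm v)) x * C \<partial>lborel)"
    by (intro nn_integral_mono mult_left_mono C) auto
  also have "\<dots> = (\<integral>\<^sup>+x. g x * indicator (ball 0 (r + norm v)) x \<partial>lborel) * C"
    by (rule nn_integral_multc) measurable
  also have "\<dots> < \<infinity>" using fin C(1) by (simp add: ennreal_mult_less_top)
  finally show ?thesis .
qed

text \<open>The case \<open>g = 1\<close>, with \<open>v\<close> the multiple of \<zeta> normalised
  to \<zeta> \<bullet> v = 1.\<close>

lemma nn_integral_inv_sqrt_inner_finite:
  fixes \<zeta> :: "'a::euclidean_space"
  assumes "\<zeta> \<noteq> 0"
  shows "(\<integral>\<^sup>+x. inv_sqrt (\<zeta> \<bullet> x) * indicator (ball 0 r) x \<partial>lborel) < \<infinity>"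
proof -
  have "(\<integral>\<^sup>+x. 1 * indicator (ball (0::'a) (r + norm (\<zeta> /\<^sub>R (\<zeta> \<bullet> \<zeta>)))) x \<partial>lborel) < \<infinity>"
    using emeasure_lborel_ball_finite[of "0::'a" "r + norm (\<zeta> /\<^sub>R (\<zeta> \<bullet> \<zeta>))"] by simp
  then show ?thesis
    using nn_integral_inv_sqrt_inner_bound[of \<zeta> "\<zeta> /\<^sub>R (\<zeta> \<bullet> \<zeta>)" "\<lambda>_. 1" r] assms by simp
qed

text \<open>\<open>p\<close> is the part of \<zeta> orthogonal to \<zeta>'. Translating along
  \<open>p\<close> changes \<zeta> \<bullet> x but not \<zeta>' \<bullet> x, so the second factor
  can play the part of \<open>g\<close>.\<close>

lemma nn_integral_inv_sqrt_inner2_finite: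
  fixes \<zeta> \<zeta>' :: "'a::euclidean_space"
  assumes "\<zeta>' \<noteq> 0" and ind: "\<And>c. \<zeta> \<noteq> c *\<^sub>R \<zeta>'"
  shows "(\<integral>\<^sup>+x. inv_sqrt (\<zeta> \<bullet> x) * inv_sqrt (\<zeta>' \<bullet> x) * indicator (ball 0 r) x \<partial>lborel) < \<infinity>"
proof -
  define p where "p = \<zeta> - ((\<zeta> \<bullet> \<zeta>') / (\<zeta>' \<bullet> \<zeta>')) *\<^sub>R \<zeta>'"
  have "p \<noteq> 0" using ind by (simp add: p_def)
  have orth: "\<zeta>' \<bullet> p = 0" using assms(1) by (simp add: p_def inner_diff_right inner_commute)
  have "\<zeta> \<bullet> p = p \<bullet> p"
    using orth by (simp add: p_def inner_diff_left inner_diff_right inner_commute)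
  then have nz: "\<zeta> \<bullet> p \<noteq> 0" using \<open>p \<noteq> 0\<close> by simp
  show ?thesis
    by (rule nn_integral_inv_sqrt_inner_bound[of \<zeta> "p /\<^sub>R (\<zeta> \<bullet> p)"])
       (use nz orth nn_integral_inv_sqrt_inner_finite[OF assms(1)] in \<open>auto simp: inner_diff_right\<close>)
qed

lemma nn_integral_inverse_singular:
  fixes a \<epsilon> :: real
  assumes "0 < a" "a \<le> \<epsilon>"
  shows "(\<integral>\<^sup>+s. ennreal (1 / \<bar>a - s\<bar>) * indicator {0..\<epsilon>} s \<partial>lborel) = \<infinity>"
proof -
  have "of_nat n \<le> (\<integral>\<^sup>+s. ennreal (1 / \<bar>a - s\<bar>) * indicator {0..\<epsilon>} s \<partial>lborel)" for n
  proof -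
    \<comment> \<open>Chosen so that the integral from 0 to \<open>b\<close>, which is ln (a / (a -
      b)), equals \<open>n\<close> exactly.\<close>
    define b where "b = a - a * exp (- real n)"
    have b: "0 \<le> b" "b < a" using assms(1) by (auto simp: b_def)
    have "(\<integral>\<^sup>+s. ennreal (1 / \<bar>a - s\<bar>) * indicator {0..b} s \<partial>lborel) = - ln (a - b) - - ln (a - 0)"
      using b by (intro nn_integral_FTC_Icc) (auto intro!: derivative_eq_intros simp: divide_simps)
    also have "- ln (a - b) - - ln (a - 0) = real n"
      using assms(1) by (simp add: b_def ln_mult)
    finally have "of_nat n = (\<integral>\<^sup>+s. ennreal (1 / \<bar>a - s\<bar>) * indicator {0..b} s \<partial>lborel)"
      by (simp add: ennreal_of_nat_eq_real_of_nat)
    also have "\<dots> \<le> (\<integral>\<^sup>+s. ennreal (1 / \<bar>a - s\<bar>) * indicator {0..\<epsilon>} s \<partial>lborel)"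
      using b assms by (intro nn_integral_mono) (auto simp: indicator_def)
    finally show ?thesis .
  qed
  then have "(SUP n. of_nat n) \<le> (\<integral>\<^sup>+s. ennreal (1 / \<bar>a - s\<bar>) * indicator {0..\<epsilon>} s \<partial>lborel)"
    by (rule SUP_least)
  then show ?thesis by (simp add: ennreal_SUP_of_nat_eq_top top_unique)
qed

lemma emeasure_open_pos:
  fixes U :: "'a::euclidean_space set"
  assumes "open U" "U \<noteq> {}"
  shows "0 < emeasure lborel U"
proof -
  obtain x e where e: "0 < e" "ball x e \<subseteq> U"
    using assms by (metis all_not_in_conv openE)
  have "emeasure lborel (ball x e) \<le> emeasure lborel U"
    by (rule emeasure_mono) (use e assms in auto)
  moreover have "0 < emeasure lborel (ball x e)"
    using e(1) by (simp add: emeasure_ball)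
  ultimately show ?thesis by (metis order_less_le_trans)
qed

text \<open>For x in the nonempty open set \<open>U\<close> on the positive side of the hyperplane,
  the segment in direction -v crosses the zero set of \<zeta> inside \<open>K\<close>, so the
  averaged inner integral is infinite on a set of positive measure.\<close>

lemma nn_integral_inverse_inner_infinite:
  fixes \<zeta> :: "'a::euclidean_space"
  assumes "\<zeta> \<noteq> 0" and K: "open K" "p \<in> K" and p: "\<zeta> \<bullet> p = 0"
  shows "(\<integral>\<^sup>+x. ennreal (1 / \<bar>\<zeta> \<bullet> x\<bar>) * indicator K x \<partial>lborel) = \<infinity>"
proof -
  define v where "v = \<zeta> /\<^sub>R (\<zeta> \<bullet> \<zeta>)"
  have v: "\<zeta> \<bullet> v = 1" using assms(1) by (simp add: v_def)
  obtain e where e: "0 < e" "ball p e \<subseteq> K" using K by (meson openE)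
  \<comment> \<open>Two bounds are needed: at most 1, to stay within the averaging interval, and so
    small that a segment starting within e / 2 of \<open>p\<close> stays in the ball of radius
    \<open>e\<close>.\<close>
  define \<epsilon> where "\<epsilon> = min 1 (e / (4 * (norm v + 1)))"
  have nv: "0 < norm v + 1" by (simp add: add_nonneg_pos)
  have \<epsilon>: "0 < \<epsilon>" "\<epsilon> \<le> 1" using e(1) nv by (auto simp: \<epsilon>_def)
  have "\<epsilon> * (norm v + 1) \<le> e / 4"
  proof -
    have "\<epsilon> \<le> e / (4 * (norm v + 1))" by (simp add: \<epsilon>_def)
    then show ?thesis using nv by (simp add: pos_le_divide_eq algebra_simps)
  qed
  then have \<epsilon>v: "\<epsilon> * norm v < e / 2" using \<epsilon> e(1) by (simp add: algebra_simps)
  define U where "U = ball p (e / 2) \<inter> {x. 0 < \<zeta> \<bullet> x \<and> \<zeta> \<bullet> x < \<epsilon>}"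
  have "open U"
    unfolding U_def by (intro open_Int open_ball open_Collect_conj open_Collect_less continuous_intros)
  moreover have "p + (\<epsilon> / 2) *\<^sub>R v \<in> U"
    using \<epsilon> \<epsilon>v p v e(1) by (auto simp: U_def dist_norm inner_add_right)
  ultimately have Upos: "0 < emeasure lborel U"
    by (intro emeasure_open_pos) auto
  have [measurable]: "U \<in> sets borel" using \<open>open U\<close> by simp
  have [measurable]: "K \<in> sets borel" using K(1) by simp
  have "\<infinity> = (\<integral>\<^sup>+x. \<infinity> * indicator U x \<partial>lborel)"
    using Upos by (subst nn_integral_cmult) (simp_all add: ennreal_top_mult)
  also have "\<dots> \<le> (\<integral>\<^sup>+x. (\<integral>\<^sup>+s. ennreal (1 / \<bar>\<zeta> \<bullet> (x - s *\<^sub>R v)\<bar>) * indicator K (x - s *\<^sub>R v)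
        * indicator {0..1} s \<partial>lborel) \<partial>lborel)"
  proof (rule nn_integral_mono)
    fix x
    show "\<infinity> * indicator U x \<le> (\<integral>\<^sup>+s. ennreal (1 / \<bar>\<zeta> \<bullet> (x - s *\<^sub>R v)\<bar>) * indicator K (x - s *\<^sub>R v)
        * indicator {0..1} s \<partial>lborel)"
    proof (cases "x \<in> U")
      case True
      then have x: "dist p x < e / 2" "0 < \<zeta> \<bullet> x" "\<zeta> \<bullet> x < \<epsilon>" by (auto simp: U_def)
      have "x - s *\<^sub>R v \<in> K" if "s \<in> {0..\<epsilon>}" for s
      proof -
        have "dist x (x - s *\<^sub>R v) = s * norm v" using that by (simp add: dist_norm)
        also have "\<dots> \<le> \<epsilon> * norm v" using that by (intro mult_right_mono) auto
        finally have "dist p (x - s *\<^sub>R v) < e"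
          using x(1) \<epsilon>v dist_triangle[of p "x - s *\<^sub>R v" x] by linarith
        then show ?thesis using e(2) by auto
      qed
      then have "(\<integral>\<^sup>+s. ennreal (1 / \<bar>\<zeta> \<bullet> x - s\<bar>) * indicator {0..\<epsilon>} s \<partial>lborel)
         \<le> (\<integral>\<^sup>+s. ennreal (1 / \<bar>\<zeta> \<bullet> (x - s *\<^sub>R v)\<bar>) * indicator K (x - s *\<^sub>R v)
        * indicator {0..1} s \<partial>lborel)"
        using \<epsilon> by (intro nn_integral_mono) (auto simp: indicator_def inner_diff_right v)
      then show ?thesis using nn_integral_inverse_singular[of "\<zeta> \<bullet> x" \<epsilon>] x by (simp add: top_unique)
    qed simp
  qed
  also have "\<dots> = (\<integral>\<^sup>+x. ennreal (1 / \<bar>\<zeta> \<bullet> x\<bar>) * indicator K x \<partial>lborel)"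
    by (rule nn_integral_average_translates[symmetric]) measurable
  finally show ?thesis by (simp add: top_unique)
qed

subsection \<open>Plane waves and distributional derivatives\<close>

text \<open>Derivatives at points of an open set depend only on the values there. This allows an
  explicit formula for the derivative, known on \<open>S\<close> alone, to replace
  \<open>frechet_derivative\<close>.\<close>

lemma Ck_on_cong:
  assumes "open S" "\<And>x. x \<in> S \<Longrightarrow> f x = g x"
  shows "Ck_on k S f \<longleftrightarrow> Ck_on k S g"
  using assms(2)
proof (induction k arbitrary: f g)
  case 0
  then show ?case by (auto cong: continuous_on_cong)
next
  case (Suc k)
  have imp: "Ck_on (Suc k) S g" if *: "\<forall>x\<in>S. f x = g x" "Ck_on (Suc k) S f" for f g :: "'a \<Rightarrow> 'b"
  proof -
    have "g differentiable at x" if "x \<in> S" for x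
    proof -
      have "f differentiable at x" using *(2) that by simp
      then obtain D where "(f has_derivative D) (at x)"
        unfolding differentiable_def by (rule exE)
      then have "(g has_derivative D) (at x)"
        using *(1) that assms(1) by (metis has_derivative_transform_within_open)
      then show ?thesis by (auto simp: differentiable_def)
    qed
    moreover have "Ck_on k S (\<lambda>x. frechet_derivative g (at x) v)" for v
    proof -
      have "frechet_derivative f (at x) v = frechet_derivative g (at x) v" if "x \<in> S" for x
        using frechet_derivative_transform_within_open[of f x S g] * that assms(1) by auto
      moreover have "Ck_on k S (\<lambda>x. frechet_derivative f (at x) v)" using *(2) by simp
      ultimately show ?thesis
        using Suc.IH[of "\<lambda>x. frechet_derivative f (at x) v" "\<lambda>x. frechet_derivative g (at x) v"] by simp
    qed
    ultimately show ?thesis by simp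
  qed
  have fg: "\<forall>x\<in>S. f x = g x" using Suc.prems by (rule ballI)
  have gf: "\<forall>x\<in>S. g x = f x" by (rule ballI, rule Suc.prems[symmetric])
  show ?case using imp[OF fg] imp[OF gf] by (rule iffI)
qed

text \<open>This is Re (\<phi> (\<zeta> \<bullet> x) (\<eta> + i \<eta>')) with \<zeta> = \<xi> + i
  \<xi>', written out in real terms so that no complexification of the target space is
  needed.\<close>

definition plane_wave ::
  "(complex \<Rightarrow> complex) \<Rightarrow> 'a::real_inner \<Rightarrow> 'a \<Rightarrow> 'b::real_normed_vector \<Rightarrow> 'b \<Rightarrow> 'a \<Rightarrow> 'b" where
  "plane_wave \<phi> \<xi> \<xi>' \<eta> \<eta>' x =
     Re (\<phi> (Complex (\<xi> \<bullet> x) (\<xi>' \<bullet> x))) *\<^sub>R \<eta> - Im (\<phi> (Complex (\<xi> \<bullet> x) (\<xi>' \<bullet> x))) *\<^sub>R \<eta>'"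

text \<open>The chain rule multiplies the amplitude \<eta> + i \<eta>' by the complex number \<xi>
  \<bullet> h + i (\<xi>' \<bullet> h); the two new amplitudes are the real and imaginary parts of
  the product.\<close>

lemma plane_wave_has_derivative:
  assumes "\<phi> holomorphic_on P" "open P" "Complex (\<xi> \<bullet> x) (\<xi>' \<bullet> x) \<in> P"
  shows "(plane_wave \<phi> \<xi> \<xi>' \<eta> \<eta>' has_derivative
    (\<lambda>h. plane_wave (deriv \<phi>) \<xi> \<xi>' ((\<xi> \<bullet> h) *\<^sub>R \<eta> - (\<xi>' \<bullet> h) *\<^sub>R \<eta>') ((\<xi>' \<bullet> h) *\<^sub>R \<eta> + (\<xi> \<bullet> h) *\<^sub>R \<eta>') x)) (at x)"
proof -
  define L where "L x = Complex (\<xi> \<bullet> x) (\<xi>' \<bullet> x)" for x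
  have L: "L = (\<lambda>x. of_real (\<xi> \<bullet> x) + \<i> * of_real (\<xi>' \<bullet> x))"
    by (simp add: L_def Complex_eq fun_eq_iff)
  have "(L has_derivative L) (at x)"
    unfolding L by (auto intro!: derivative_eq_intros)
  moreover have "(\<phi> has_derivative (*) (deriv \<phi> (L x))) (at (L x))"
    using assms by (metis L_def has_field_derivative_def holomorphic_derivI)
  ultimately have "((\<lambda>y. \<phi> (L y)) has_derivative (\<lambda>h. deriv \<phi> (L x) * L h)) (at x)"
    by (rule has_derivative_compose)
  then have "((\<lambda>y. Re (\<phi> (L y)) *\<^sub>R \<eta> - Im (\<phi> (L y)) *\<^sub>R \<eta>') has_derivative
      (\<lambda>h. Re (deriv \<phi> (L x) * L h) *\<^sub>R \<eta> - Im (deriv \<phi> (L x) * L h) *\<^sub>R \<eta>')) (at x)"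
    by (auto intro!: derivative_eq_intros)
  moreover have "(\<lambda>h. Re (deriv \<phi> (L x) * L h) *\<^sub>R \<eta> - Im (deriv \<phi> (L x) * L h) *\<^sub>R \<eta>')
    = (\<lambda>h. plane_wave (deriv \<phi>) \<xi> \<xi>' ((\<xi> \<bullet> h) *\<^sub>R \<eta> - (\<xi>' \<bullet> h) *\<^sub>R \<eta>') ((\<xi>' \<bullet> h) *\<^sub>R \<eta> + (\<xi> \<bullet> h) *\<^sub>R \<eta>') x)"
    by (rule ext) (simp add: plane_wave_def L_def scaleR_left_diff_distrib scaleR_left_distrib
        scaleR_right_diff_distrib scaleR_right_distrib)
  ultimately show ?thesis by (simp add: plane_wave_def[abs_def] L_def)
qed

text \<open>A directional derivative is again a plane wave, for the holomorphic function
  \<open>deriv \<phi>\<close> and other amplitudes, so the induction generalises over all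
  three.\<close>

lemma plane_wave_Cinf_on:
  assumes "\<phi> holomorphic_on P" "open P" "open S" and S: "\<And>x. x \<in> S \<Longrightarrow> Complex (\<xi> \<bullet> x) (\<xi>' \<bullet> x) \<in> P"
  shows "plane_wave \<phi> \<xi> \<xi>' \<eta> \<eta>' \<in> Cinf_on S"
proof -
  have "Ck_on k S (plane_wave \<phi> \<xi> \<xi>' \<eta> \<eta>')" for k
    using assms(1)
  proof (induction k arbitrary: \<phi> \<eta> \<eta>')
    case 0
    have "continuous (at x within S) (plane_wave \<phi> \<xi> \<xi>' \<eta> \<eta>')" if "x \<in> S" for x
      using plane_wave_has_derivative[OF 0 assms(2) S[OF that]]
      by (rule has_derivative_continuous[OF has_derivative_at_withinI])
    then show ?case by (simp add: continuous_on_eq_continuous_within)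
  next
    case (Suc k)
    note deriv = plane_wave_has_derivative[OF Suc.prems assms(2) S]
    have "Ck_on k S (\<lambda>x. frechet_derivative (plane_wave \<phi> \<xi> \<xi>' \<eta> \<eta>') (at x) v)" for v
    proof -
      have eq: "frechet_derivative (plane_wave \<phi> \<xi> \<xi>' \<eta> \<eta>') (at x) v
          = plane_wave (deriv \<phi>) \<xi> \<xi>' ((\<xi> \<bullet> v) *\<^sub>R \<eta> - (\<xi>' \<bullet> v) *\<^sub>R \<eta>')
              ((\<xi>' \<bullet> v) *\<^sub>R \<eta> + (\<xi> \<bullet> v) *\<^sub>R \<eta>') x" if "x \<in> S" for x
        using fun_cong[OF frechet_derivative_at[OF deriv[OF that]], of v] by (rule sym)
      show ?thesis
        by (rule Ck_on_cong[OF assms(3) eq, THEN iffD2])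
           (assumption, rule Suc.IH[OF holomorphic_deriv[OF Suc.prems assms(2)]])
    qed
    moreover have "plane_wave \<phi> \<xi> \<xi>' \<eta> \<eta>' differentiable at x" if "x \<in> S" for x
      using deriv[OF that] by (rule differentiableI)
    ultimately show ?case by simp
  qed
  then show ?thesis by (simp add: Cinf_on_def)
qed

text \<open>
  The integrals of the difference quotients vanish by translation invariance, and the quotients are
  dominated by a multiple of the indicator of a fixed ball.
\<close>

lemma integral_directional_derivative_eq_0:
  fixes w :: "'a::euclidean_space \<Rightarrow> 'b::euclidean_space"
  assumes D: "\<And>x. (w has_derivative D x) (at x)" and cont: "continuous_on UNIV (\<lambda>x. D x e)"
    and K: "compact K" "\<And>x. x \<notin> K \<Longrightarrow> w x = 0"
  shows "integrable lborel (\<lambda>x. D x e)" "(\<integral>x. D x e \<partial>lborel) = 0"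
proof -
  have D0: "D x e = 0" if "x \<notin> K" for x
  proof -
    have "(w has_derivative (\<lambda>h. 0)) (at x)"
      by (rule has_derivative_transform_within_open[of "\<lambda>_. 0" _ _ UNIV "- K"])
         (use that K in \<open>auto intro: compact_imp_closed open_Compl\<close>)
    from has_derivative_unique[OF D this] show ?thesis by simp
  qed
  have wcont: "continuous_on UNIV w"
    using D by (meson continuous_at_imp_continuous_on has_derivative_continuous)
  have int: "integrable lborel f" if "continuous_on UNIV f" "\<And>x. x \<notin> K \<Longrightarrow> f x = 0" for f :: "'a \<Rightarrow> 'b"
  proof -
    have "integrable lborel (\<lambda>x. indicator K x *\<^sub>R f x)"
      by (rule borel_integrable_compact) (use K(1) continuous_on_subset[OF that(1)] in auto)
    moreover have "(\<lambda>x. indicator K x *\<^sub>R f x) = f" using that by (auto simp: indicator_def fun_eq_iff)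
    ultimately show ?thesis by simp
  qed
  show "integrable lborel (\<lambda>x. D x e)" by (rule int[OF cont D0])
  have "bounded ((\<lambda>x. D x e) ` K)"
    by (intro compact_imp_bounded compact_continuous_image continuous_on_subset[OF cont] K) auto
  \<comment> \<open>The bound on the compact set \<open>K\<close> is global, since the derivative
    vanishes off \<open>K\<close>.\<close>
  then obtain M where M: "0 \<le> M" "\<And>x. norm (D x e) \<le> M"
    using D0 unfolding bounded_iff by (metis image_eqI norm_ge_zero norm_zero order_trans linear)
  obtain R where R: "\<And>x. x \<in> K \<Longrightarrow> norm x \<le> R"
    using compact_imp_bounded[OF K(1)] by (auto simp: bounded_iff)
  define f where "f n x = real (Suc n) *\<^sub>R (w (x + (1 / real (Suc n)) *\<^sub>R e) - w x)" for n x
  have lip: "norm (w (x + t *\<^sub>R e) - w x) \<le> M * t" if "0 \<le> t" for x t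
  proof -
    have "norm (w (x + t *\<^sub>R e) - w (x + 0 *\<^sub>R e)) \<le> M * norm (t - 0)"
    proof (rule differentiable_bound[of UNIV "\<lambda>t. w (x + t *\<^sub>R e)" "\<lambda>t h. h *\<^sub>R D (x + t *\<^sub>R e) e"])
      fix s :: real
      have "((\<lambda>t. w (x + t *\<^sub>R e)) has_derivative (\<lambda>h. D (x + s *\<^sub>R e) (h *\<^sub>R e))) (at s)"
        by (rule has_derivative_compose[OF _ D]) (auto intro!: derivative_eq_intros)
      then show "((\<lambda>t. w (x + t *\<^sub>R e)) has_derivative (\<lambda>h. h *\<^sub>R D (x + s *\<^sub>R e) e)) (at s within UNIV)"
        by (simp add: linear_scale[OF has_derivative_linear[OF D]])
      show "onorm (\<lambda>h. h *\<^sub>R D (x + s *\<^sub>R e) e) \<le> M"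
        by (rule onorm_le) (simp add: mult.commute[of M] mult_left_mono[OF M(2)])
    qed auto
    then show ?thesis using that by simp
  qed
  have fbound: "norm (f n x) \<le> M * indicator (cball 0 (R + norm e)) x" for n x
  proof (cases "x \<in> cball 0 (R + norm e)")
    case True
    have "norm (f n x) \<le> real (Suc n) * (M * (1 / real (Suc n)))"
      unfolding f_def by (simp only: norm_scaleR abs_of_nat) (intro mult_left_mono lip, auto)
    then show ?thesis using True by simp
  next
    case False
    \<comment> \<open>A step no longer than \<open>e\<close> cannot reach \<open>K\<close> from
      outside the enlarged ball, so both values of \<open>w\<close> in the quotient vanish.\<close>
    have small: "norm ((1 / real (Suc n)) *\<^sub>R e) \<le> norm e"
      by (simp add: divide_le_eq mult_le_cancel_left1)
    have "x \<notin> K" using False R[of x] by (auto intro: add_increasing2)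
    moreover have "x + (1 / real (Suc n)) *\<^sub>R e \<notin> K"
    proof
      assume "x + (1 / real (Suc n)) *\<^sub>R e \<in> K"
      then have "norm (x + (1 / real (Suc n)) *\<^sub>R e) \<le> R" by (rule R)
      then show False
        using False small norm_triangle_ineq4[of "x + (1 / real (Suc n)) *\<^sub>R e" "(1 / real (Suc n)) *\<^sub>R e"]
        by simp
    qed
    ultimately show ?thesis using False K(2) by (simp add: f_def)
  qed
  have lim: "(\<lambda>n. f n x) \<longlonglongrightarrow> D x e" for x
  \<comment> \<open>The Frechet limit is taken along nonzero increments, which calls for a nonzero
    \<open>e\<close>.\<close>
  proof (cases "e = 0")
    case True
    then show ?thesis using linear_0[OF has_derivative_linear[OF D]] by (simp add: f_def)
  next
    case False
    have "((\<lambda>h. norm (w (x + h) - w x - D x h) / norm h) \<longlongrightarrow> 0) (at 0)"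
      using D[of x] by (simp add: has_derivative_at)
    moreover have "filterlim (\<lambda>n. (1 / real (Suc n)) *\<^sub>R e) (at 0) sequentially"
      unfolding filterlim_at
      using tendsto_scaleR[OF LIMSEQ_inverse_real_of_nat tendsto_const[of e]] False
      by (simp add: inverse_eq_divide)
    ultimately have "(\<lambda>n. norm (w (x + (1 / real (Suc n)) *\<^sub>R e) - w x - D x ((1 / real (Suc n)) *\<^sub>R e))
        / norm ((1 / real (Suc n)) *\<^sub>R e)) \<longlonglongrightarrow> 0"
      by (rule filterlim_compose)
    from tendsto_mult_left[OF this, of "norm e"]
    have "(\<lambda>n. norm e * (norm (w (x + (1 / real (Suc n)) *\<^sub>R e) - w x - D x ((1 / real (Suc n)) *\<^sub>R e))
        / norm ((1 / real (Suc n)) *\<^sub>R e))) \<longlonglongrightarrow> 0" by simp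
    moreover have "norm e * (norm (w (x + (1 / real (Suc n)) *\<^sub>R e) - w x - D x ((1 / real (Suc n)) *\<^sub>R e))
        / norm ((1 / real (Suc n)) *\<^sub>R e)) = norm (f n x - D x e)" for n
    proof -
      have "f n x - D x e
          = real (Suc n) *\<^sub>R (w (x + (1 / real (Suc n)) *\<^sub>R e) - w x - D x ((1 / real (Suc n)) *\<^sub>R e))"
        unfolding linear_scale[OF has_derivative_linear[OF D]]
        by (simp add: f_def scaleR_diff_right del: of_nat_Suc)
      then show ?thesis using False by (simp add: norm_mult del: of_nat_Suc)
    qed
    ultimately have "(\<lambda>n. norm (f n x - D x e)) \<longlonglongrightarrow> 0" by simp
    then show ?thesis by (simp add: LIM_zero_iff tendsto_norm_zero_iff)
  qed
  have fint: "(\<integral>x. f n x \<partial>lborel) = 0" for n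
  proof -
    have trans: "integrable lborel (\<lambda>x. w (c + x))" "(\<integral>x. w (c + x) \<partial>lborel) = (\<integral>x. w x \<partial>lborel)" for c
    proof -
      have m [measurable]: "w \<in> borel_measurable borel"
        using wcont by (rule borel_measurable_continuous_onI)
      have "integrable (distr lborel borel ((+) c)) w" "(\<integral>x. w x \<partial>distr lborel borel ((+) c)) = (\<integral>x. w x \<partial>lborel)"
        using int[OF wcont K(2)] by (simp_all add: lborel_distr_plus)
      then show "integrable lborel (\<lambda>x. w (c + x))" "(\<integral>x. w (c + x) \<partial>lborel) = (\<integral>x. w x \<partial>lborel)"
        by (simp_all add: integrable_distr_eq integral_distr)
    qed
    show ?thesis
      unfolding f_def
      using trans[of "(1 / real (Suc n)) *\<^sub>R e"] int[OF wcont K(2)]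
      by (simp add: Bochner_Integration.integral_diff add.commute)
  qed
  have "(\<lambda>n. \<integral>x. f n x \<partial>lborel) \<longlonglongrightarrow> (\<integral>x. D x e \<partial>lborel)"
  proof (rule integral_dominated_convergence[where w = "\<lambda>x. M * indicator (cball 0 (R + norm e)) x"])
    show "(\<lambda>x. D x e) \<in> borel_measurable lborel"
      using cont by (simp add: borel_measurable_continuous_onI)
    show "f n \<in> borel_measurable lborel" for n
      unfolding f_def
      by (simp, intro borel_measurable_continuous_onI continuous_intros continuous_on_compose2[OF wcont]) auto
    show "integrable lborel (\<lambda>x. M * indicator (cball 0 (R + norm e)) x)"
      using emeasure_lborel_cball_finite by (intro integrable_mult_right integrable_real_indicator) auto
  qed (use lim fbound in auto)
  then show "(\<integral>x. D x e \<partial>lborel) = 0" by (simp add: fint LIMSEQ_const_iff)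
qed

text \<open>For a test function \<phi>, the operator applied to \<phi> u is \<phi> times the
  classical A u, which is 0, plus the integrand paired with u in the definition. As \<phi> u is
  compactly supported and continuously differentiable, the integrals of its derivatives
  vanish.\<close>

lemma distributional_op_0I:
  fixes A :: "'n::finite \<Rightarrow> real ^ 'N \<Rightarrow> real ^ 'K"
  assumes A: "\<And>\<alpha>. linear (A \<alpha>)" and \<Omega>: "open \<Omega>"
    and D: "\<And>x. x \<in> \<Omega> \<Longrightarrow> (u has_derivative D x) (at x)"
    and cont: "\<And>v. continuous_on \<Omega> (\<lambda>x. D x v)"
    and eq0: "\<And>x. x \<in> \<Omega> \<Longrightarrow> (\<Sum>\<alpha>\<in>UNIV. A \<alpha> (D x (axis \<alpha> 1))) = 0"
  shows "distributional_op A \<Omega> u (\<lambda>_. 0)"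
  unfolding distributional_op_def
proof
  fix \<phi> assume \<phi>: "\<phi> \<in> test_functions \<Omega>"
  define d where "d x = frechet_derivative \<phi> (at x)" for x
  define K where "K = closure (support_on UNIV \<phi>)"
  have K: "compact K" "K \<subseteq> \<Omega>" and \<phi>C: "Ck_on (Suc 0) UNIV \<phi>"
    using \<phi> by (auto simp: test_functions_def K_def Cinf_on_def)
  have d: "(\<phi> has_derivative d x) (at x)" and dcont: "continuous_on UNIV (\<lambda>x. d x v)" for x v
    using \<phi>C by (auto simp: d_def frechet_derivative_works)
  have \<phi>cont: "continuous_on UNIV \<phi>"
    using d by (meson continuous_at_imp_continuous_on has_derivative_continuous)
  have \<phi>0: "\<phi> x = 0" if "x \<notin> K" for x
    using that closure_subset[of "support_on UNIV \<phi>"] by (auto simp: K_def support_on_def)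
  have Kopen: "open (- K)" using K(1) by (simp add: compact_imp_closed open_Compl)
  have d0: "d x = (\<lambda>_. 0)" if "x \<notin> K" for x
  proof -
    have "(\<phi> has_derivative (\<lambda>_. 0)) (at x)"
      by (rule has_derivative_transform_within_open[of "\<lambda>_. 0" _ _ UNIV "- K"])
         (use that Kopen \<phi>0 in auto)
    from has_derivative_unique[OF d this] show ?thesis .
  qed
  \<comment> \<open>The product continued by 0. It agrees with \<phi> u on \<Omega> and with 0 on
    the complement of \<open>K\<close>; these two open sets cover the space, so regularity can be
    checked on each.\<close>
  define w where "w x = (if x \<in> K then \<phi> x *\<^sub>R u x else 0)" for x
  define W where "W x h = (if x \<in> \<Omega> then \<phi> x *\<^sub>R D x h + d x h *\<^sub>R u x else 0)" for x h
  have W: "(w has_derivative W x) (at x)" for x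
  proof (cases "x \<in> \<Omega>")
    case True
    have "((\<lambda>x. \<phi> x *\<^sub>R u x) has_derivative W x) (at x)"
      using True d D[OF True] by (auto simp: W_def intro!: derivative_eq_intros)
    then show ?thesis
      by (rule has_derivative_transform_within_open[OF _ \<Omega> True]) (auto simp: w_def \<phi>0)
  next
    case False
    then have "x \<in> - K" using K by auto
    moreover have "((\<lambda>_. 0) has_derivative W x) (at x)" using False by (simp add: W_def[abs_def])
    ultimately show ?thesis
      using has_derivative_transform_within_open[OF _ Kopen, of "\<lambda>_. 0" "W x" x UNIV w] by (auto simp: w_def)
  qed
  have ucont: "continuous_on \<Omega> u"
    using D by (meson continuous_at_imp_continuous_on has_derivative_continuous)
  have Wcont: "continuous_on UNIV (\<lambda>x. W x v)" for v
  proof -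
    have "continuous_on \<Omega> (\<lambda>x. \<phi> x *\<^sub>R D x v + d x v *\<^sub>R u x)"
      by (intro continuous_intros cont ucont continuous_on_subset[OF \<phi>cont] continuous_on_subset[OF dcont]) auto
    then have 1: "continuous_on \<Omega> (\<lambda>x. W x v)"
      by (rule continuous_on_eq) (simp add: W_def)
    have 2: "continuous_on (- K) (\<lambda>x. W x v)"
      by (rule continuous_on_eq[of _ "\<lambda>_. 0"]) (auto simp: W_def \<phi>0 d0)
    have "continuous_on (\<Omega> \<union> - K) (\<lambda>x. W x v)" by (rule continuous_on_open_Un[OF \<Omega> Kopen 1 2])
    moreover have "\<Omega> \<union> - K = UNIV" using K by auto
    ultimately show ?thesis by simp
  qed
  have intW: "integrable lborel (\<lambda>x. W x v)" "(\<integral>x. W x v \<partial>lborel) = 0" for v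
    using integral_directional_derivative_eq_0[OF W Wcont K(1)] by (auto simp: w_def)
  have blin: "bounded_linear (A \<alpha>)" for \<alpha> using A by (simp add: linear_conv_bounded_linear)
  have pointwise: "indicator \<Omega> x *\<^sub>R (\<Sum>\<alpha>\<in>UNIV. d x (axis \<alpha> 1) *\<^sub>R A \<alpha> (u x))
      = (\<Sum>\<alpha>\<in>UNIV. A \<alpha> (W x (axis \<alpha> 1)))" for x
  proof (cases "x \<in> \<Omega>")
    case True
    then have "(\<Sum>\<alpha>\<in>UNIV. A \<alpha> (W x (axis \<alpha> 1)))
      = \<phi> x *\<^sub>R (\<Sum>\<alpha>\<in>UNIV. A \<alpha> (D x (axis \<alpha> 1))) + (\<Sum>\<alpha>\<in>UNIV. d x (axis \<alpha> 1) *\<^sub>R A \<alpha> (u x))"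
      by (simp add: W_def linear_add[OF A] linear_scale[OF A] sum.distrib scaleR_sum_right)
    then show ?thesis using True eq0 by simp
  qed (simp add: W_def linear_0[OF A])
  have meas: "(\<lambda>x. \<Sum>\<alpha>\<in>UNIV. A \<alpha> (W x (axis \<alpha> 1))) \<in> borel_measurable lborel"
    by (simp, intro borel_measurable_continuous_onI continuous_intros
          bounded_linear.continuous_on[OF blin] Wcont)
  \<comment> \<open>By \<open>pointwise\<close> the integrand is a function continuous on the whole
    space, so the completed measure can be replaced by \<open>lborel\<close>.\<close>
  have "(LINT x:\<Omega>|lebesgue. (\<Sum>\<alpha>\<in>UNIV. d x (axis \<alpha> 1) *\<^sub>R A \<alpha> (u x)))
      = (\<integral>x. (\<Sum>\<alpha>\<in>UNIV. A \<alpha> (W x (axis \<alpha> 1))) \<partial>lborel)"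
    unfolding set_lebesgue_integral_def pointwise by (rule integral_completion[OF meas])
  also have "\<dots> = (\<Sum>\<alpha>\<in>UNIV. A \<alpha> (\<integral>x. W x (axis \<alpha> 1) \<partial>lborel))"
    by (subst Bochner_Integration.integral_sum)
       (auto intro!: integrable_bounded_linear[OF blin] integral_bounded_linear[OF blin] sum.cong intW)
  also have "\<dots> = 0" by (simp add: intW linear_0[OF A])
  finally show "(LINT x:\<Omega>|lebesgue. \<phi> x *\<^sub>R (0 :: real ^ 'K)) =
      - (LINT x:\<Omega>|lebesgue. (\<Sum>\<alpha>\<in>UNIV. frechet_derivative \<phi> (at x) (axis \<alpha> 1) *\<^sub>R A \<alpha> (u x)))"
    by (simp add: d_def)
qed

subsection \<open>The counterexample\<close>

definition real_symbol :: "('n::finite \<Rightarrow> real ^ 'N \<Rightarrow> real ^ 'K) \<Rightarrow> real ^ 'n \<Rightarrow> real ^ 'N \<Rightarrow> real ^ 'K" where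
  "real_symbol A \<xi> \<eta> = (\<Sum>\<alpha>\<in>UNIV. \<xi> $ \<alpha> *\<^sub>R A \<alpha> \<eta>)"

lemma real_symbol_scaleR_left [simp]: "real_symbol A (c *\<^sub>R \<xi>) \<eta> = c *\<^sub>R real_symbol A \<xi> \<eta>"
  by (simp add: real_symbol_def scaleR_sum_right)

lemma real_symbol_scaleR_right:
  "(\<And>\<alpha>. linear (A \<alpha>)) \<Longrightarrow> real_symbol A \<xi> (c *\<^sub>R \<eta>) = c *\<^sub>R real_symbol A \<xi> \<eta>"
  by (simp add: real_symbol_def scaleR_sum_right linear_scale mult.commute)

lemma real_symbol_0_left [simp]: "real_symbol A 0 \<eta> = 0"
  by (simp add: real_symbol_def)

lemma real_symbol_0_right: "(\<And>\<alpha>. linear (A \<alpha>)) \<Longrightarrow> real_symbol A \<xi> 0 = 0"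
  by (simp add: real_symbol_def linear_0)

text \<open>The two equations are the real and imaginary parts of A[\<xi>] \<eta> = 0, where \<eta>
  is the difference of two vectors with the same image under the symbol.\<close>

lemma not_C_elliptic_obtains:
  fixes A :: "'n::finite \<Rightarrow> real ^ 'N \<Rightarrow> real ^ 'K"
  assumes A: "\<And>\<alpha>. linear (A \<alpha>)" and "\<not> C_elliptic A"
  obtains \<xi>\<^sub>1 \<xi>\<^sub>2 \<eta>\<^sub>1 \<eta>\<^sub>2 where "\<xi>\<^sub>1 \<noteq> 0 \<or> \<xi>\<^sub>2 \<noteq> 0" "\<eta>\<^sub>1 \<noteq> 0 \<or> \<eta>\<^sub>2 \<noteq> 0"
    "real_symbol A \<xi>\<^sub>1 \<eta>\<^sub>1 = real_symbol A \<xi>\<^sub>2 \<eta>\<^sub>2" "real_symbol A \<xi>\<^sub>1 \<eta>\<^sub>2 = - real_symbol A \<xi>\<^sub>2 \<eta>\<^sub>1"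
proof -
  obtain \<xi> a b where \<xi>: "\<xi> \<noteq> 0" and ab: "op_symbol A \<xi> a = op_symbol A \<xi> b" "a \<noteq> b"
    using assms(2) by (auto simp: C_elliptic_def inj_def)
  define \<eta> where "\<eta> = a - b"
  have comp: "complexify (A \<alpha>) (a - b) = complexify (A \<alpha>) a - complexify (A \<alpha>) b" for \<alpha>
  proof -
    have eqs: "(\<chi> j. Re ((a - b) $ j)) = (\<chi> j. Re (a $ j)) - (\<chi> j. Re (b $ j))"
      "(\<chi> j. Im ((a - b) $ j)) = (\<chi> j. Im (a $ j)) - (\<chi> j. Im (b $ j))"
      by (simp_all add: vec_eq_iff)
    then show ?thesis
      unfolding complexify_def eqs linear_diff[OF A] by (simp add: vec_eq_iff complex_eq_iff)
  qed
  have "op_symbol A \<xi> \<eta> = op_symbol A \<xi> a - op_symbol A \<xi> b"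
    by (simp add: op_symbol_def \<eta>_def comp vector_sub_rdistrib sum_subtractf vec_eq_iff right_diff_distrib)
  then have zero: "op_symbol A \<xi> \<eta> = 0" using ab by simp
  let ?x1 = "\<chi> j. Re (\<xi> $ j)" and ?x2 = "\<chi> j. Im (\<xi> $ j)"
  let ?y1 = "\<chi> j. Re (\<eta> $ j)" and ?y2 = "\<chi> j. Im (\<eta> $ j)"
  have comp0: "(\<Sum>\<alpha>\<in>UNIV. \<xi> $ \<alpha> * Complex (A \<alpha> ?y1 $ k) (A \<alpha> ?y2 $ k)) = 0" for k
    using zero by (simp add: op_symbol_def complexify_def vec_eq_iff)
  show thesis
  proof (rule that)
    show "?x1 \<noteq> 0 \<or> ?x2 \<noteq> 0" using \<xi> by (auto simp: vec_eq_iff complex_eq_iff)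
    show "?y1 \<noteq> 0 \<or> ?y2 \<noteq> 0" using ab(2) by (auto simp: \<eta>_def vec_eq_iff complex_eq_iff)
    show "real_symbol A ?x1 ?y1 = real_symbol A ?x2 ?y2"
      using arg_cong[OF comp0, of Re] by (simp add: real_symbol_def vec_eq_iff sum_subtractf)
    show "real_symbol A ?x1 ?y2 = - real_symbol A ?x2 ?y1"
      using arg_cong[OF comp0, of Im] by (simp add: real_symbol_def vec_eq_iff sum.distrib add_eq_0_iff2)
  qed
qed

text \<open>Classically, A u is the real part of \<phi>' (\<xi> \<bullet> x) A[\<xi>] \<eta>, and
  \<open>sym\<close> says that A[\<xi>] \<eta> = 0. The distributional A u is thus the zero
  function, and integrability of u is all that remains.\<close>

lemma plane_wave_in_W_A1:
  fixes A :: "'n::finite \<Rightarrow> real ^ 'N \<Rightarrow> real ^ 'K"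
  assumes A: "\<And>\<alpha>. linear (A \<alpha>)" and \<phi>: "\<phi> holomorphic_on P" "open P"
    and \<Omega>: "open \<Omega>" "\<And>x. x \<in> \<Omega> \<Longrightarrow> Complex (\<xi>\<^sub>1 \<bullet> x) (\<xi>\<^sub>2 \<bullet> x) \<in> P"
    and sym: "real_symbol A \<xi>\<^sub>1 \<eta>\<^sub>1 = real_symbol A \<xi>\<^sub>2 \<eta>\<^sub>2" "real_symbol A \<xi>\<^sub>1 \<eta>\<^sub>2 = - real_symbol A \<xi>\<^sub>2 \<eta>\<^sub>1"
    and fin: "(\<integral>\<^sup>+x. ennreal (norm (plane_wave \<phi> \<xi>\<^sub>1 \<xi>\<^sub>2 \<eta>\<^sub>1 \<eta>\<^sub>2 x)) * indicator \<Omega> x \<partial>lborel) < \<infinity>"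
  shows "plane_wave \<phi> \<xi>\<^sub>1 \<xi>\<^sub>2 \<eta>\<^sub>1 \<eta>\<^sub>2 \<in> W_A1 A \<Omega>"
proof -
  let ?u = "plane_wave \<phi> \<xi>\<^sub>1 \<xi>\<^sub>2 \<eta>\<^sub>1 \<eta>\<^sub>2"
  define D where "D x h = plane_wave (deriv \<phi>) \<xi>\<^sub>1 \<xi>\<^sub>2 ((\<xi>\<^sub>1 \<bullet> h) *\<^sub>R \<eta>\<^sub>1 - (\<xi>\<^sub>2 \<bullet> h) *\<^sub>R \<eta>\<^sub>2)
     ((\<xi>\<^sub>2 \<bullet> h) *\<^sub>R \<eta>\<^sub>1 + (\<xi>\<^sub>1 \<bullet> h) *\<^sub>R \<eta>\<^sub>2) x" for x h
  have cont: "continuous_on \<Omega> (plane_wave \<psi> \<xi>\<^sub>1 \<xi>\<^sub>2 \<eta> \<eta>')" if "\<psi> holomorphic_on P" for \<psi> and \<eta> \<eta>' :: "real ^ 'N"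
    using plane_wave_Cinf_on[OF that \<phi>(2) \<Omega>] unfolding Cinf_on_def by (metis Ck_on.simps(1) mem_Collect_eq)
  have "distributional_op A \<Omega> ?u (\<lambda>_. 0)"
  proof (rule distributional_op_0I[OF A \<Omega>(1)])
    show "(?u has_derivative D x) (at x)" if "x \<in> \<Omega>" for x
      unfolding D_def using plane_wave_has_derivative[OF \<phi> \<Omega>(2)[OF that]] .
    show "continuous_on \<Omega> (\<lambda>x. D x v)" for v
      unfolding D_def by (rule cont) (rule holomorphic_deriv[OF \<phi>])
    show "(\<Sum>\<alpha>\<in>UNIV. A \<alpha> (D x (axis \<alpha> 1))) = 0" if "x \<in> \<Omega>" for x
    proof -
      define p q where "p = Re (deriv \<phi> (Complex (\<xi>\<^sub>1 \<bullet> x) (\<xi>\<^sub>2 \<bullet> x)))"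
        and "q = Im (deriv \<phi> (Complex (\<xi>\<^sub>1 \<bullet> x) (\<xi>\<^sub>2 \<bullet> x)))"
      have "A \<alpha> (D x (axis \<alpha> 1)) = p *\<^sub>R (\<xi>\<^sub>1 $ \<alpha> *\<^sub>R A \<alpha> \<eta>\<^sub>1) - p *\<^sub>R (\<xi>\<^sub>2 $ \<alpha> *\<^sub>R A \<alpha> \<eta>\<^sub>2)
          - (q *\<^sub>R (\<xi>\<^sub>2 $ \<alpha> *\<^sub>R A \<alpha> \<eta>\<^sub>1) + q *\<^sub>R (\<xi>\<^sub>1 $ \<alpha> *\<^sub>R A \<alpha> \<eta>\<^sub>2))" for \<alpha>
        by (simp add: D_def plane_wave_def p_def q_def inner_axis linear_diff[OF A] linear_add[OF A]
            linear_scale[OF A] scaleR_diff_right scaleR_add_right)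
      then have "(\<Sum>\<alpha>\<in>UNIV. A \<alpha> (D x (axis \<alpha> 1)))
        = p *\<^sub>R real_symbol A \<xi>\<^sub>1 \<eta>\<^sub>1 - p *\<^sub>R real_symbol A \<xi>\<^sub>2 \<eta>\<^sub>2
          - (q *\<^sub>R real_symbol A \<xi>\<^sub>2 \<eta>\<^sub>1 + q *\<^sub>R real_symbol A \<xi>\<^sub>1 \<eta>\<^sub>2)"
        by (simp only: sum_subtractf sum.distrib real_symbol_def scaleR_sum_right)
      then show ?thesis by (simp add: sym)
    qed
  qed
  moreover have "?u absolutely_integrable_on \<Omega>"
  proof -
    have m: "(\<lambda>x. indicator \<Omega> x *\<^sub>R ?u x) \<in> borel_measurable lborel"
      using borel_measurable_continuous_on_indicator[OF _ cont[OF \<phi>(1)]] \<Omega>(1) by simp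
    have "integrable lborel (\<lambda>x. indicator \<Omega> x *\<^sub>R ?u x)"
    proof (rule integrableI_bounded[OF m])
      have "(\<integral>\<^sup>+x. ennreal (norm (indicator \<Omega> x *\<^sub>R ?u x)) \<partial>lborel)
          = (\<integral>\<^sup>+x. ennreal (norm (?u x)) * indicator \<Omega> x \<partial>lborel)"
        by (intro nn_integral_cong) (auto simp: indicator_def)
      then show "(\<integral>\<^sup>+x. ennreal (norm (indicator \<Omega> x *\<^sub>R ?u x)) \<partial>lborel) < \<infinity>" using fin by simp
    qed
    then show ?thesis using m by (simp add: set_integrable_def integrable_completion)
  qed
  moreover have "(\<lambda>_. 0 :: real ^ 'K) absolutely_integrable_on \<Omega>" by simp
  ultimately show ?thesis unfolding W_A1_def by blast
qed

text \<open>Needed for \<open>Lim\<close> to be determined by convergence. Points of the half ball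
  near \<open>x\<close> are reached by moving from \<open>x\<close> in the direction \<xi>.\<close>

lemma at_within_half_ball_neq_bot:
  fixes \<xi> :: "'a::real_inner"
  assumes "\<xi> \<noteq> 0" "\<xi> \<bullet> x = 0" "norm x < 1"
  shows "at x within {x \<in> ball 0 1. \<xi> \<bullet> x > 0} \<noteq> bot"
proof -
  have "x islimpt {x \<in> ball 0 1. \<xi> \<bullet> x > 0}"
    unfolding islimpt_approachable
  proof (intro allI impI)
    fix e :: real assume "0 < e"
    \<comment> \<open>The displacement has half the length of the smaller of \<open>e\<close> and
      the distance to the unit sphere.\<close>
    define t where "t = min e (1 - norm x) / (2 * norm \<xi>)"
    have t: "0 < t" using \<open>0 < e\<close> assms by (simp add: t_def)
    have "t * norm \<xi> = min e (1 - norm x) / 2" using assms(1) by (simp add: t_def)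
    then have tn: "t * norm \<xi> \<le> e / 2" "t * norm \<xi> \<le> (1 - norm x) / 2" by simp_all
    have "norm (x + t *\<^sub>R \<xi>) < 1" using norm_triangle_ineq[of x "t *\<^sub>R \<xi>"] tn t assms(3) by simp
    then show "\<exists>y\<in>{x \<in> ball 0 1. \<xi> \<bullet> x > 0}. y \<noteq> x \<and> dist y x < e"
      using assms t tn \<open>0 < e\<close> by (intro bexI[of _ "x + t *\<^sub>R \<xi>"]) (auto simp: dist_norm inner_add_right)
  qed
  then show ?thesis by (simp add: trivial_limit_within)
qed

text \<open>\<open>q k\<close> projects onto the hyperplane along the \<open>k\<close>-th axis,
  which is transverse to it as \<xi> $ k is nonzero. A finite multiple of the Hausdorff integral of
  \<open>G\<close> dominates the slab integral of \<open>G o q k\<close>.\<close>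

lemma nn_integral_trace_infinite:
  fixes \<xi> :: "real ^ 'n::finite" and u :: "real ^ 'n \<Rightarrow> 'b::real_normed_vector"
  defines "Bplus \<equiv> {x \<in> ball 0 1. \<xi> \<bullet> x > 0}"
  defines "q \<equiv> \<lambda>k x. x - (\<xi> \<bullet> x / \<xi> $ k) *\<^sub>R axis k 1"
  assumes k: "\<xi> $ k \<noteq> 0" and G [measurable]: "G \<in> borel_measurable borel"
    and lim: "\<And>x. \<xi> \<bullet> x = 0 \<Longrightarrow> norm x < 1 \<Longrightarrow> ((\<lambda>y. ennreal (norm (u y))) \<longlongrightarrow> G x) (at x within Bplus)"
    and inf: "(\<integral>\<^sup>+x. G (q k x) * indicator {x. norm (q k x) < 1 \<and> 0 < x $ k \<and> x $ k < 1} x \<partial>lborel) = \<infinity>"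
  shows "(\<integral>\<^sup>+x\<in>{x. \<xi> \<bullet> x = 0} \<inter> ball 0 1. Lim (at x within Bplus) (\<lambda>y. ennreal (norm (u y)))
    \<partial>hausdorff_measure (CARD('n) - 1)) = \<infinity>"
proof -
  define C where "C = ennreal (4 ^ (CARD('n) - 1) / unit_ball_vol (real (CARD('n) - 1)))"
  define f where "f x = G x * indicator ({x. \<xi> \<bullet> x = 0} \<inter> ball 0 1) x" for x
  have [measurable]: "{x. \<xi> \<bullet> x = 0} \<inter> ball 0 1 \<in> sets borel"
    by (intro borel_closed borel_open sets.Int closed_Collect_eq continuous_intros) auto
  have q0: "\<xi> \<bullet> q k x = 0" for x
    using k by (simp add: q_def inner_diff_right inner_axis)
  have [measurable]: "q k \<in> borel_measurable borel"
    unfolding q_def by (intro borel_measurable_continuous_onI continuous_intros) (use k in auto)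
  have "\<infinity> \<le> (\<integral>\<^sup>+x. f (q k x) * indicator {x. 0 \<le> x $ k \<and> x $ k \<le> 1} x \<partial>lborel)"
    unfolding inf[symmetric] by (intro nn_integral_mono) (auto simp: f_def q0 indicator_def)
  also have "\<dots> \<le> C * (\<integral>\<^sup>+x. f x \<partial>hausdorff_measure (CARD('n) - 1))"
    unfolding C_def by (rule nn_integral_le_hausdorff) (auto simp: q_def axis_def f_def[abs_def])
  finally have "(\<integral>\<^sup>+x. f x \<partial>hausdorff_measure (CARD('n) - 1)) = \<infinity>"
    by (auto simp: top_unique C_def ennreal_mult_eq_top_iff)
  moreover have "Lim (at x within Bplus) (\<lambda>y. ennreal (norm (u y))) = G x"
    if "x \<in> {x. \<xi> \<bullet> x = 0} \<inter> ball 0 1" for x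
    using that k unfolding Bplus_def
    by (intro tendsto_Lim at_within_half_ball_neq_bot lim[unfolded Bplus_def]) auto
  then have "(\<integral>\<^sup>+x\<in>{x. \<xi> \<bullet> x = 0} \<inter> ball 0 1. Lim (at x within Bplus) (\<lambda>y. ennreal (norm (u y)))
    \<partial>hausdorff_measure (CARD('n) - 1)) = (\<integral>\<^sup>+x. f x \<partial>hausdorff_measure (CARD('n) - 1))"
    by (intro nn_integral_cong) (auto simp: f_def indicator_def)
  ultimately show ?thesis by simp
qed

text \<open>Both |a| and |b| are at most |z|, so the geometric mean is too. This splits the
  singularity of 1 / z into two factors, each depending on one linear form. For b = 0 the right side
  is infinite.\<close>

lemma inverse_norm_le_inv_sqrt:
  assumes "0 < a"
  shows "ennreal (norm (inverse (Complex a b))) \<le> inv_sqrt a * inv_sqrt b"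
proof (cases "b = 0")
  case True
  have "inv_sqrt b = \<infinity>" using True by (simp add: inv_sqrt_def)
  moreover have "inv_sqrt a \<noteq> 0" using assms by (simp add: inv_sqrt_def inverse_ennreal)
  ultimately show ?thesis by (simp add: ennreal_mult_top)
next
  case False
  let ?z = "Complex a b"
  have pos: "0 < norm ?z" using assms by (simp add: complex_eq_iff)
  have "sqrt \<bar>a\<bar> * sqrt \<bar>b\<bar> \<le> sqrt (norm ?z) * sqrt (norm ?z)"
    using abs_Re_le_cmod[of ?z] abs_Im_le_cmod[of ?z] by (intro mult_mono) auto
  then have "inverse (norm ?z) \<le> inverse (sqrt \<bar>a\<bar> * sqrt \<bar>b\<bar>)"
    using assms False by (intro le_imp_inverse_le) auto
  then show ?thesis
    using assms False unfolding inv_sqrt_def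
    by (simp add: inverse_ennreal ennreal_mult[symmetric] norm_inverse)
qed

text \<open>The part common to both cases of the theorem. Divergence is required on neighbourhoods
  of \<open>axis k (1/2)\<close> because this point lies inside the slab and projects to the centre
  of the ball.\<close>

lemma plane_wave_counterexample:
  fixes A :: "'n::finite \<Rightarrow> real ^ 'N \<Rightarrow> real ^ 'K"
  assumes A: "\<And>\<alpha>. linear (A \<alpha>)" and \<phi>: "\<phi> holomorphic_on {z. 0 < Re z}"
    and sym: "real_symbol A \<xi>\<^sub>1 \<eta>\<^sub>1 = real_symbol A \<xi>\<^sub>2 \<eta>\<^sub>2" "real_symbol A \<xi>\<^sub>1 \<eta>\<^sub>2 = - real_symbol A \<xi>\<^sub>2 \<eta>\<^sub>1"
    and k: "\<xi>\<^sub>1 $ k \<noteq> 0" and G: "G \<in> borel_measurable borel"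
    and fin: "(\<integral>\<^sup>+x. ennreal (norm (plane_wave \<phi> \<xi>\<^sub>1 \<xi>\<^sub>2 \<eta>\<^sub>1 \<eta>\<^sub>2 x)) * indicator {x \<in> ball 0 1. \<xi>\<^sub>1 \<bullet> x > 0} x \<partial>lborel) < \<infinity>"
    and lim: "\<And>x. \<xi>\<^sub>1 \<bullet> x = 0 \<Longrightarrow> norm x < 1 \<Longrightarrow>
       ((\<lambda>y. ennreal (norm (plane_wave \<phi> \<xi>\<^sub>1 \<xi>\<^sub>2 \<eta>\<^sub>1 \<eta>\<^sub>2 y))) \<longlongrightarrow> G x) (at x within {x \<in> ball 0 1. \<xi>\<^sub>1 \<bullet> x > 0})"
    and inf: "\<And>K. open K \<Longrightarrow> axis k (1/2) \<in> K \<Longrightarrow>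
       (\<integral>\<^sup>+x. G (x - (\<xi>\<^sub>1 \<bullet> x / \<xi>\<^sub>1 $ k) *\<^sub>R axis k 1) * indicator K x \<partial>lborel) = \<infinity>"
  shows "let Bplus = {x \<in> ball 0 1. \<xi>\<^sub>1 \<bullet> x > 0};
         H = {x. \<xi>\<^sub>1 \<bullet> x = 0};
         Hm = hausdorff_measure (CARD('n) - 1)
     in \<exists>u \<in> W_A1 A Bplus \<inter> Cinf_on Bplus.
          (AE x\<^sub>0 in Hm. x\<^sub>0 \<in> H \<inter> ball 0 1 \<longrightarrow>
             (\<exists>l::ennreal. ((\<lambda>y. ennreal (norm (u y))) \<longlongrightarrow> l) (at x\<^sub>0 within Bplus))) \<and>
          (\<integral>\<^sup>+x\<^sub>0\<in>H \<inter> ball 0 1.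
             Lim (at x\<^sub>0 within Bplus) (\<lambda>y. ennreal (norm (u y))) \<partial>Hm) = \<infinity>"
proof -
  define Bplus where "Bplus = {x \<in> ball 0 1. \<xi>\<^sub>1 \<bullet> x > 0}"
  let ?u = "plane_wave \<phi> \<xi>\<^sub>1 \<xi>\<^sub>2 \<eta>\<^sub>1 \<eta>\<^sub>2"
  have P: "open {z. 0 < Re z}" by (simp add: open_halfspace_Re_gt)
  have "Bplus = ball 0 1 \<inter> {x. \<xi>\<^sub>1 \<bullet> x > 0}" by (auto simp: Bplus_def)
  then have B: "open Bplus" by (simp add: open_Int open_halfspace_gt)
  have BP: "Complex (\<xi>\<^sub>1 \<bullet> x) (\<xi>\<^sub>2 \<bullet> x) \<in> {z. 0 < Re z}" if "x \<in> Bplus" for x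
    using that by (simp add: Bplus_def)
  have "?u \<in> W_A1 A Bplus"
    by (rule plane_wave_in_W_A1[OF A \<phi> P B BP sym fin[folded Bplus_def]])
  moreover have "?u \<in> Cinf_on Bplus"
    by (rule plane_wave_Cinf_on[OF \<phi> P B BP])
  moreover have "(\<integral>\<^sup>+x\<^sub>0\<in>{x. \<xi>\<^sub>1 \<bullet> x = 0} \<inter> ball 0 1. Lim (at x\<^sub>0 within Bplus) (\<lambda>y. ennreal (norm (?u y)))
      \<partial>hausdorff_measure (CARD('n) - 1)) = \<infinity>"
    unfolding Bplus_def
  proof (rule nn_integral_trace_infinite[OF k G lim])
    show "(\<integral>\<^sup>+x. G (x - (\<xi>\<^sub>1 \<bullet> x / \<xi>\<^sub>1 $ k) *\<^sub>R axis k 1)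
        * indicator {x. norm (x - (\<xi>\<^sub>1 \<bullet> x / \<xi>\<^sub>1 $ k) *\<^sub>R axis k 1) < 1 \<and> 0 < x $ k \<and> x $ k < 1} x \<partial>lborel) = \<infinity>"
    proof (rule inf)
      show "open {x. norm (x - (\<xi>\<^sub>1 \<bullet> x / \<xi>\<^sub>1 $ k) *\<^sub>R axis k 1) < 1 \<and> 0 < x $ k \<and> x $ k < 1}"
        using k by (intro open_Collect_conj open_Collect_less continuous_intros) auto
      have "(1 / 2) *\<^sub>R axis k 1 = (axis k (1 / 2) :: real ^ 'n)"
        by (simp add: vec_eq_iff axis_def)
      then show "axis k (1 / 2) \<in> {x. norm (x - (\<xi>\<^sub>1 \<bullet> x / \<xi>\<^sub>1 $ k) *\<^sub>R axis k 1) < 1 \<and> 0 < x $ k \<and> x $ k < 1}"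
        using k by (simp add: inner_axis)
    qed
  qed auto
  moreover have "AE x\<^sub>0 in hausdorff_measure (CARD('n) - 1). x\<^sub>0 \<in> {x. \<xi>\<^sub>1 \<bullet> x = 0} \<inter> ball 0 1 \<longrightarrow>
             (\<exists>l::ennreal. ((\<lambda>y. ennreal (norm (?u y))) \<longlongrightarrow> l) (at x\<^sub>0 within Bplus))"
    using lim unfolding Bplus_def by (intro AE_I2) auto
  ultimately show ?thesis unfolding Let_def Bplus_def by blast
qed

lemma eventually_at_half_ball:
  "eventually (\<lambda>y. \<xi> \<bullet> y > 0 \<and> norm y < 1) (at x within {x \<in> ball 0 1. \<xi> \<bullet> x > 0})"
  by (auto simp: eventually_at_filter)

theorem theorem4p18:
  fixes A :: "'n::finite \<Rightarrow> real ^ 'N \<Rightarrow> real ^ 'K"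
  assumes "\<And>\<alpha>. linear (A \<alpha>)"
    and "\<not> C_elliptic A"
  shows "\<exists>\<xi>\<^sub>1 :: real ^ 'n. \<xi>\<^sub>1 \<noteq> 0 \<and>
    (let Bplus = {x \<in> ball 0 1. \<xi>\<^sub>1 \<bullet> x > 0};
         H = {x. \<xi>\<^sub>1 \<bullet> x = 0};
         Hm = hausdorff_measure (CARD('n) - 1)
     in \<exists>u \<in> W_A1 A Bplus \<inter> Cinf_on Bplus.
          (AE x\<^sub>0 in Hm. x\<^sub>0 \<in> H \<inter> ball 0 1 \<longrightarrow>
             (\<exists>l::ennreal. ((\<lambda>y. ennreal (norm (u y))) \<longlongrightarrow> l) (at x\<^sub>0 within Bplus))) \<and>
          (\<integral>\<^sup>+x\<^sub>0\<in>H \<inter> ball 0 1.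
             Lim (at x\<^sub>0 within Bplus) (\<lambda>y. ennreal (norm (u y))) \<partial>Hm) = \<infinity>)"
proof (cases "\<exists>\<xi> \<eta>. \<xi> \<noteq> 0 \<and> \<eta> \<noteq> 0 \<and> real_symbol A \<xi> \<eta> = 0")

  \<comment> \<open>Real kernel vector: profile 1 / sqrt z\<close>
  case True
  then obtain \<xi> \<eta> where \<xi>: "\<xi> \<noteq> 0" and \<eta>: "\<eta> \<noteq> 0" and zero: "real_symbol A \<xi> \<eta> = 0" by blast
  have [measurable]: "ball (0 :: real ^ 'n) 1 \<in> sets borel" by simp
  obtain k where k: "\<xi> $ k \<noteq> 0" using \<xi> by (auto simp: vec_eq_iff)
  define \<phi> where "\<phi> z = inverse (csqrt z)" for z
  let ?u = "plane_wave \<phi> \<xi> 0 \<eta> 0"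
  have norm_u: "norm (?u x) = norm \<eta> * inverse (sqrt (\<xi> \<bullet> x))" if "0 < \<xi> \<bullet> x" for x
  proof -
    have "\<phi> (Complex (\<xi> \<bullet> x) (0 \<bullet> x)) = of_real (inverse (sqrt (\<xi> \<bullet> x)))"
      unfolding \<phi>_def of_real_inverse using that by (subst csqrt_of_real_nonneg) auto
    then have "norm (?u x) = \<bar>inverse (sqrt (\<xi> \<bullet> x))\<bar> * norm \<eta>"
      by (simp only: plane_wave_def Re_complex_of_real Im_complex_of_real scaleR_zero_left diff_zero norm_scaleR)
    then show ?thesis
      using that by (simp only: mult.commute abs_of_nonneg inverse_nonnegative_iff_nonnegative real_sqrt_ge_0_iff less_imp_le)
  qed
  show ?thesis
  proof (intro exI[of _ \<xi>] conjI \<xi>, rule plane_wave_counterexample[where A = A and \<phi> = \<phi>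
        and \<eta>\<^sub>1 = \<eta> and \<xi>\<^sub>2 = 0 and \<eta>\<^sub>2 = 0 and G = "\<lambda>_. \<infinity>", OF assms(1) _ _ _ k])
    show "\<phi> holomorphic_on {z. 0 < Re z}"
      unfolding \<phi>_def by (intro holomorphic_intros) (auto simp: complex_nonpos_Reals_iff)
    show "real_symbol A \<xi> \<eta> = real_symbol A 0 0" "real_symbol A \<xi> 0 = - real_symbol A 0 \<eta>"
      by (simp_all add: zero real_symbol_0_right[of A, OF assms(1)])
    have "(\<integral>\<^sup>+x. ennreal (norm (?u x)) * indicator {x \<in> ball 0 1. \<xi> \<bullet> x > 0} x \<partial>lborel)
        \<le> (\<integral>\<^sup>+x. ennreal (norm \<eta>) * (inv_sqrt (\<xi> \<bullet> x) * indicator (ball 0 1) x) \<partial>lborel)"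
      by (intro nn_integral_mono)
         (auto simp: indicator_def norm_u ennreal_mult inv_sqrt_def inverse_ennreal)
    also have "\<dots> = ennreal (norm \<eta>) * (\<integral>\<^sup>+x. inv_sqrt (\<xi> \<bullet> x) * indicator (ball 0 1) x \<partial>lborel)"
      by (rule nn_integral_cmult) measurable
    also have "\<dots> < \<infinity>"
      using nn_integral_inv_sqrt_inner_finite[OF \<xi>, of 1] by (simp add: ennreal_mult_less_top)
    finally show "(\<integral>\<^sup>+x. ennreal (norm (?u x)) * indicator {x \<in> ball 0 1. \<xi> \<bullet> x > 0} x \<partial>lborel) < \<infinity>" .
    show "((\<lambda>y. ennreal (norm (?u y))) \<longlongrightarrow> \<infinity>) (at x within {x \<in> ball 0 1. \<xi> \<bullet> x > 0})"
      if "\<xi> \<bullet> x = 0" for x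
    proof -
      let ?F = "at x within {x \<in> ball 0 1. \<xi> \<bullet> x > 0}"
      have ev: "eventually (\<lambda>y. 0 < \<xi> \<bullet> y) ?F"
        using eventually_at_half_ball by (rule eventually_mono) simp
      have "((\<lambda>y. sqrt (\<xi> \<bullet> y)) \<longlongrightarrow> sqrt (\<xi> \<bullet> x)) ?F" by (intro tendsto_intros)
      then have "LIM y ?F. inverse (sqrt (\<xi> \<bullet> y)) :> at_top"
        using that ev by (intro filterlim_inverse_at_top) (auto elim: eventually_mono)
      then have "LIM y ?F. norm \<eta> * inverse (sqrt (\<xi> \<bullet> y)) :> at_top"
        using \<eta> by (intro filterlim_tendsto_pos_mult_at_top[OF tendsto_const]) auto
      moreover have "eventually (\<lambda>y. norm \<eta> * inverse (sqrt (\<xi> \<bullet> y)) \<le> norm (?u y)) ?F"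
        using ev by (rule eventually_mono) (simp add: norm_u)
      ultimately have "LIM y ?F. norm (?u y) :> at_top"
        by (rule filterlim_at_top_mono)
      then show ?thesis by (simp add: ennreal_tendsto_top_eq_at_top)
    qed
    show "(\<integral>\<^sup>+x. \<infinity> * indicator K x \<partial>lborel) = \<infinity>" if "open K" "axis k (1/2) \<in> K" for K :: "(real ^ 'n) set"
      using emeasure_open_pos[OF that(1)] that by (subst nn_integral_cmult) (force simp: ennreal_top_mult)+
  qed auto
next

  \<comment> \<open>Injective real symbol: profile 1 / z\<close>
  case False
  then have inj: "\<eta> = 0" if "real_symbol A \<xi> \<eta> = 0" "\<xi> \<noteq> 0" for \<xi> \<eta> using that by blast
  obtain x1 x2 y1 y2 where nz: "x1 \<noteq> 0 \<or> x2 \<noteq> 0" "y1 \<noteq> 0 \<or> y2 \<noteq> 0"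
    and sym: "real_symbol A x1 y1 = real_symbol A x2 y2" "real_symbol A x1 y2 = - real_symbol A x2 y1"
    by (rule not_C_elliptic_obtains[OF assms])
  \<comment> \<open>If the wave vectors or the amplitudes were proportional, the two symbol
    equations would combine to c^2 v = - v for some value v of the real symbol.\<close>
  have sq: "v = 0" if "c *\<^sub>R c *\<^sub>R v = - v" for c and v :: "real ^ 'K"
  proof -
    have "(c * c + 1) *\<^sub>R v = 0" using that by (simp add: scaleR_add_left)
    moreover have "c * c + 1 \<noteq> 0" using zero_le_square[of c] by linarith
    ultimately show ?thesis by simp
  qed
  have x2: "x2 \<noteq> 0"
  proof
    assume "x2 = 0"
    then have "real_symbol A x1 y1 = 0" "real_symbol A x1 y2 = 0" using sym by auto
    then show False using nz \<open>x2 = 0\<close> inj by blast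
  qed
  have x12: "x1 \<noteq> c *\<^sub>R x2" for c
  proof
    assume x1: "x1 = c *\<^sub>R x2"
    have "c *\<^sub>R c *\<^sub>R real_symbol A x2 y1 = - real_symbol A x2 y1"
      using sym unfolding x1 by simp
    then have "real_symbol A x2 y1 = 0" by (rule sq)
    moreover from this have "real_symbol A x2 y2 = 0" using sym(1) unfolding x1 by simp
    ultimately show False using inj x2 nz(2) by blast
  qed
  have x21: "x2 \<noteq> c *\<^sub>R x1" for c
  proof
    assume *: "x2 = c *\<^sub>R x1"
    then have "c \<noteq> 0" using x2 by auto
    then have "x1 = (1 / c) *\<^sub>R x2" using * by simp
    then show False using x12 by blast
  qed
  have x1: "x1 \<noteq> 0" using x12[of 0] by simp
  have y2: "y2 \<noteq> 0"
    using sym(2) inj[of x2 y1] nz(2) x2 real_symbol_0_right[of A, OF assms(1)] by auto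
  have y12: "y1 \<noteq> c *\<^sub>R y2" for c
  proof
    assume y1: "y1 = c *\<^sub>R y2"
    have "c *\<^sub>R c *\<^sub>R real_symbol A x1 y2 = - real_symbol A x1 y2"
      using sym unfolding y1 real_symbol_scaleR_right[of A, OF assms(1)] by simp
    then have "real_symbol A x1 y2 = 0" by (rule sq)
    then show False using inj x1 y2 by blast
  qed
  \<comment> \<open>The real-linear map taking w to Re (w (y1 + i y2)). Independence of
    \<open>y1\<close> and \<open>y2\<close> makes it injective, hence bounded below, and this keeps
    |u| comparable to 1 / |L x|.\<close>
  define f where "f w = Re w *\<^sub>R y1 - Im w *\<^sub>R y2" for w
  have "linear f"
    by (rule linearI) (simp_all add: f_def scaleR_add_left scaleR_diff_right)
  moreover have "inj f"
    unfolding linear_injective_0[OF \<open>linear f\<close>]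
  proof (intro allI impI)
    fix w assume "f w = 0"
    then have eq: "Re w *\<^sub>R y1 = Im w *\<^sub>R y2" by (simp add: f_def)
    have "Re w = 0"
    proof (rule ccontr)
      assume "Re w \<noteq> 0"
      then have "y1 = (1 / Re w) *\<^sub>R (Re w *\<^sub>R y1)" by simp
      then have "y1 = (Im w / Re w) *\<^sub>R y2" unfolding eq by simp
      then show False using y12 by blast
    qed
    then show "w = 0" using eq y2 by (simp add: complex_eq_iff)
  qed
  ultimately obtain b where b: "0 < b" "\<And>w. b * norm w \<le> norm (f w)"
    using linear_inj_bounded_below_pos[of f] by blast
  have f_upper: "norm (f w) \<le> (norm y1 + norm y2) * norm w" for w
  proof -
    have "norm (f w) \<le> \<bar>Re w\<bar> * norm y1 + \<bar>Im w\<bar> * norm y2"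
      unfolding f_def using norm_triangle_ineq4[of "Re w *\<^sub>R y1" "Im w *\<^sub>R y2"] by simp
    also have "\<dots> \<le> norm w * norm y1 + norm w * norm y2"
      by (intro add_mono mult_right_mono abs_Re_le_cmod abs_Im_le_cmod) auto
    finally show ?thesis by (simp add: algebra_simps)
  qed
  have [measurable]: "ball (0 :: real ^ 'n) 1 \<in> sets borel" by simp
  obtain k where k: "x1 $ k \<noteq> 0" using x1 by (auto simp: vec_eq_iff)
  define L where "L x = Complex (x1 \<bullet> x) (x2 \<bullet> x)" for x
  let ?u = "plane_wave inverse x1 x2 y1 y2"
  have u: "?u x = f (inverse (L x))" for x by (simp add: plane_wave_def f_def L_def)
  have Llim: "(L \<longlongrightarrow> L x) (at x within S)" for x S
    unfolding L_def by (intro tendsto_intros)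
  \<comment> \<open>On the hyperplane L x is i (x2 \<bullet> x), so its inverse is purely imaginary
    and only \<open>y2\<close> contributes. The zero set is treated apart because real division by 0
    gives 0.\<close>
  define G where "G x = (if x2 \<bullet> x = 0 then \<infinity> else ennreal (norm y2 / \<bar>x2 \<bullet> x\<bar>))" for x
  show ?thesis
  proof (intro exI[of _ x1] conjI x1, rule plane_wave_counterexample[where A = A and \<phi> = inverse and G = G,
        OF assms(1) _ sym k])
    show "inverse holomorphic_on {z. 0 < Re z}"
      by (intro holomorphic_intros) auto
    show "G \<in> borel_measurable borel" unfolding G_def by measurable
    have "(\<integral>\<^sup>+x. ennreal (norm (?u x)) * indicator {x \<in> ball 0 1. x1 \<bullet> x > 0} x \<partial>lborel)
        \<le> (\<integral>\<^sup>+x. ennreal (norm y1 + norm y2) * (inv_sqrt (x1 \<bullet> x) * inv_sqrt (x2 \<bullet> x) * indicator (ball 0 1) x) \<partial>lborel)"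
    proof (intro nn_integral_mono)
      fix x
      have "ennreal (norm (?u x)) \<le> ennreal (norm y1 + norm y2) * (inv_sqrt (x1 \<bullet> x) * inv_sqrt (x2 \<bullet> x))"
        if "0 < x1 \<bullet> x"
      proof -
        have "ennreal (norm (?u x)) \<le> ennreal (norm y1 + norm y2) * ennreal (norm (inverse (L x)))"
          unfolding u by (subst ennreal_mult[symmetric]) (simp_all add: ennreal_leI f_upper)
        also have "\<dots> \<le> ennreal (norm y1 + norm y2) * (inv_sqrt (x1 \<bullet> x) * inv_sqrt (x2 \<bullet> x))"
          unfolding L_def by (intro mult_left_mono inverse_norm_le_inv_sqrt that) auto
        finally show ?thesis .
      qed
      then show "ennreal (norm (?u x)) * indicator {x \<in> ball 0 1. x1 \<bullet> x > 0} x
        \<le> ennreal (norm y1 + norm y2) * (inv_sqrt (x1 \<bullet> x) * inv_sqrt (x2 \<bullet> x) * indicator (ball 0 1) x)"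
        by (auto simp: indicator_def)
    qed
    also have "\<dots> = ennreal (norm y1 + norm y2)
        * (\<integral>\<^sup>+x. inv_sqrt (x1 \<bullet> x) * inv_sqrt (x2 \<bullet> x) * indicator (ball 0 1) x \<partial>lborel)"
      by (rule nn_integral_cmult) measurable
    also have "\<dots> < \<infinity>"
      using nn_integral_inv_sqrt_inner2_finite[OF x2 x12, of 1] by (simp add: ennreal_mult_less_top)
    finally show "(\<integral>\<^sup>+x. ennreal (norm (?u x)) * indicator {x \<in> ball 0 1. x1 \<bullet> x > 0} x \<partial>lborel) < \<infinity>" .
    show "((\<lambda>y. ennreal (norm (?u y))) \<longlongrightarrow> G x) (at x within {x \<in> ball 0 1. x1 \<bullet> x > 0})"
      if x: "x1 \<bullet> x = 0" for x
    proof (cases "x2 \<bullet> x = 0")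
      case True
      let ?F = "at x within {x \<in> ball 0 1. x1 \<bullet> x > 0}"
      have "eventually (\<lambda>y. 0 < norm (L y)) ?F"
        using eventually_at_half_ball by (rule eventually_mono) (auto simp: L_def complex_eq_iff)
      moreover have "((\<lambda>y. norm (L y)) \<longlongrightarrow> 0) ?F"
        using tendsto_norm[OF Llim[of x]] x True by (simp add: L_def complex_norm)
      ultimately have "LIM y ?F. inverse (norm (L y)) :> at_top"
        by (intro filterlim_inverse_at_top)
      then have "LIM y ?F. b * inverse (norm (L y)) :> at_top"
        using b(1) by (intro filterlim_tendsto_pos_mult_at_top[OF tendsto_const]) auto
      then have "LIM y ?F. norm (?u y) :> at_top"
        by (rule filterlim_at_top_mono) (use b(2)[of "inverse (L _)"] in \<open>simp add: u norm_inverse\<close>)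
      then show ?thesis using True by (simp add: G_def ennreal_tendsto_top_eq_at_top)
    next
      case False
      then have "L x \<noteq> 0" by (simp add: L_def complex_eq_iff)
      then have "((\<lambda>y. norm (?u y)) \<longlongrightarrow> norm (?u x)) (at x within {x \<in> ball 0 1. x1 \<bullet> x > 0})"
        unfolding u f_def by (intro tendsto_intros Llim)
      moreover have "norm (?u x) = norm y2 / \<bar>x2 \<bullet> x\<bar>"
      proof -
        have "inverse (L x) = Complex 0 (- (1 / (x2 \<bullet> x)))"
          using False x by (simp add: L_def complex_eq_iff power2_eq_square)
        then show ?thesis unfolding u by (simp add: f_def)
      qed
      ultimately show ?thesis using False by (simp add: G_def tendsto_ennrealI)
    qed
    show "(\<integral>\<^sup>+x. G (x - (x1 \<bullet> x / x1 $ k) *\<^sub>R axis k 1) * indicator K x \<partial>lborel) = \<infinity>"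
      if K: "open K" "axis k (1/2) \<in> K" for K :: "(real ^ 'n) set"
    proof -
      \<comment> \<open>The linear form x2 composed with the projection onto the hyperplane. Its
        \<open>k\<close>-th component is 0, so it vanishes at \<open>axis k (1/2)\<close>.\<close>
      define \<zeta> where "\<zeta> = x2 - (x2 $ k / x1 $ k) *\<^sub>R x1"
      have \<zeta>0: "\<zeta> \<noteq> 0" using x21 by (simp add: \<zeta>_def)
      have \<zeta>: "x2 \<bullet> (x - (x1 \<bullet> x / x1 $ k) *\<^sub>R axis k 1) = \<zeta> \<bullet> x" for x
        by (simp add: \<zeta>_def inner_diff_left inner_diff_right inner_axis)
      have "\<infinity> = ennreal (norm y2) * (\<integral>\<^sup>+x. ennreal (1 / \<bar>\<zeta> \<bullet> x\<bar>) * indicator K x \<partial>lborel)"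
        using nn_integral_inverse_inner_infinite[OF \<zeta>0 K] k y2
        by (simp add: \<zeta>_def inner_axis inner_diff_left ennreal_mult_top)
      also have "\<dots> = (\<integral>\<^sup>+x. ennreal (norm y2) * (ennreal (1 / \<bar>\<zeta> \<bullet> x\<bar>) * indicator K x) \<partial>lborel)"
        using K(1) by (intro nn_integral_cmult[symmetric]) simp
      \<comment> \<open>An inequality only: where \<zeta> \<bullet> x = 0 the left integrand is 0 by
        real division while \<open>G\<close> is infinite.\<close>
      also have "\<dots> \<le> (\<integral>\<^sup>+x. G (x - (x1 \<bullet> x / x1 $ k) *\<^sub>R axis k 1) * indicator K x \<partial>lborel)"
        by (intro nn_integral_mono) (auto simp: G_def \<zeta> indicator_def ennreal_mult[symmetric])
      finally show ?thesis by (simp add: top_unique)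
    qed
  qed
qed

end
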